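(* Let $n\ge 1$, let $P\in\mathscr{P}_n$ be a polynomial which does not vanish in $|z|<1$, and let $B\in\mathcal{B}_n$ have parameters $\lambda_0,\lambda_1,\lambda_2$. Then for every $\alpha\in\mathbb{C}$ with $|\alpha|\le 1$, every $0\le p<\infty$ and every $R>1$, with $\sigma(z)=Rz$, $$\left\|B[P\circ\sigma](z)-\alpha B[P](z)\right\|_p\le\frac{\left\|(R^n-\alpha)\Lambda_n z+(1-\alpha)\lambda_0\right\|_p}{\|1+z\|_p}\,\|P(z)\|_p .$$ The result is best possible: equality holds for $P(z)=az^n+b$ with $|a|=|b|=1$.
   Context: $\mathscr{P}_n$ is the space of complex polynomials of degree at most $n$. For a polynomial $Q$, define $\|Q(z)\|_0:=\exp\left\{\frac1{2\pi}\int_0^{2\pi}\log|Q(e^{i\theta})|\,d\theta\right\}$ and, for $0<p<\infty$, $\|Q(z)\|_p:=\left\{\frac1{2\pi}\int_0^{2\pi}|Q(e^{i\theta})|^p\,d\theta\right\}^{1/p}$. $P\circ\sigma$ denotes the composite $(P\circ\sigma)(z)=P(\sigma(z))$. The class $\mathcal{B}_n$ consists of the operators $B$ carrying $P\in\mathscr{P}_n$ into $$B[P](z):=\lambda_0P(z)+\lambda_1\left(\frac{nz}{2}\right)\frac{P'(z)}{1!}+\lambda_2\left(\frac{nz}{2}\right)^2\frac{P''(z)}{2!},$$ where $\lambda_0,\lambda_1,\lambda_2\in\mathbb{C}$ are such that all the zeros of $U(z):=\lambda_0+\lambda_1\binom n1 z+\lambda_2\binom n2 z^2$ lie in the half plane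 $|z|\le|z-n/2|$. Also $\Lambda_n:=\lambda_0+\lambda_1\frac{n^2}{2}+\lambda_2\frac{n^3(n-1)}{8}$. *)

theory Defs
  imports "HOL-Analysis.Analysis" "HOL-Computational_Algebra.Polynomial"
begin

definition poly_space :: "nat \<Rightarrow> complex poly set" where
  "poly_space n = {P. degree P \<le> n}"

(* For p = 0 and Q = 0 the integrand is constantly minus infinity, so the geometric mean
   is exp (-infinity) = 0. This case is separate because HOL has ln 0 = 0. For Q \<noteq> 0 the
   integrand takes that junk value only at finitely many points, which the integral ignores. *)
definition circle_norm :: "real \<Rightarrow> complex poly \<Rightarrow> real" where
  "circle_norm p Q =
     (if p = 0 then
        (if Q = 0 then 0
         else exp (1 / (2 * pi) * integral {0..2 * pi} (\<lambda>t. ln (cmod (poly Q (cis t))))))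
      else (1 / (2 * pi) * integral {0..2 * pi} (\<lambda>t. cmod (poly Q (cis t)) powr p)) powr (1 / p))"

definition B_op ::
  "nat \<Rightarrow> complex \<Rightarrow> complex \<Rightarrow> complex \<Rightarrow> complex poly \<Rightarrow> complex poly" where
  "B_op n l0 l1 l2 P =
     smult l0 P
     + smult l1 ([:0, of_nat n / 2:] * smult (1 / fact 1) (pderiv P))
     + smult l2 ([:0, of_nat n / 2:] ^ 2 * smult (1 / fact 2) (pderiv (pderiv P)))"

definition U_poly :: "nat \<Rightarrow> complex \<Rightarrow> complex \<Rightarrow> complex \<Rightarrow> complex poly" where
  "U_poly n l0 l1 l2 = [:l0, l1 * of_nat (n choose 1), l2 * of_nat (n choose 2):]"

definition B_class_params :: "nat \<Rightarrow> complex \<Rightarrow> complex \<Rightarrow> complex \<Rightarrow> bool" where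
  "B_class_params n l0 l1 l2 \<longleftrightarrow>
     (\<forall>z. poly (U_poly n l0 l1 l2) z = 0 \<longrightarrow> cmod z \<le> cmod (z - of_nat n / 2))"

definition Lambda :: "nat \<Rightarrow> complex \<Rightarrow> complex \<Rightarrow> complex \<Rightarrow> complex" where
  "Lambda n l0 l1 l2 =
     l0 + l1 * (of_nat n ^ 2 / 2) + l2 * (of_nat n ^ 3 * (of_nat n - 1) / 8)"

end

theory Submission
  imports Defs "HOL-Complex_Analysis.Complex_Analysis"
    "HOL-Computational_Algebra.Fundamental_Theorem_Algebra"
begin

text \<open>
Let \<open>T[P] = B[P(R z)] - \<alpha> B[P]\<close>. On the monomials \<open>T\<close> is diagonal: it multiplies the coefficient
of \<open>z^k\<close> by \<open>g k = (R^k - \<alpha>) b_k\<close>, where \<open>b_k\<close> is the eigenvalue of \<open>B\<close> on \<open>z^k\<close>, and the two outermost factors are \<open>g 0 = (1 - \<alpha>) \<lambda>\<^sub>0\<close> and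
\<open>g n = (R^n - \<alpha>) \<Lambda>\<^sub>n\<close>. Everything follows from one property of such a multiplier: it maps
polynomials of degree \<open>n\<close> with all zeros in the closed unit disc to polynomials of the same kind
(\<open>admissible\<close>). For \<open>T\<close> this holds because \<open>|P(R z)| > |P(z)|\<close> outside the disc, so that
\<open>P(R z) - \<alpha> P(z)\<close> keeps its zeros inside, and because the value \<open>B[P](w)\<close> at an outer point \<open>w\<close>
is a constant times an iterated polar derivative of \<open>P\<close> whose poles lie outside the disc; the
condition on the zeros of \<open>U\<close> is what puts them there. Laguerre's theorem (\<open>Laguerre_polar\<close>) then
forbids \<open>B[P](w) = 0\<close>.

An admissible multiplier preserves inequalities \<open>|F| \<le> |G|\<close> outside the disc when \<open>G\<close> has its zeros
inside (\<open>multiplier_dominated\<close>). Reflecting the outer zeros of an arbitrary \<open>Q\<close> in the circle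
changes nothing on the circle, can only enlarge the image of \<open>Q\<close> there, and produces a
polynomial whose logarithmic mean is the logarithm of the modulus of its leading coefficient. So the logarithmic
mean of a nonzero image exceeds that of \<open>Q\<close> by at most \<open>ln |g n|\<close> (\<open>Mahler_multiplier\<close>). Applying this to
\<open>Q = P + r e^(ib) z^n\<close> with \<open>r = s / |g n|\<close> and averaging over \<open>b\<close> with Jensen's formula
compares the means of \<open>ln (max u s)\<close> for \<open>u\<close> the modulus of the image and
of \<open>g n P\<close>, for every \<open>s > 0\<close>; since \<open>u^p\<close> is a superposition of the functions
\<open>ln (max u s) - ln s\<close>, the same comparison holds for \<open>p\<close>-th powers (\<open>Arestov\<close>).

The factor \<open>1 / \<parallel>1 + z\<parallel>\<close> comes from a second average. Write \<open>P\<^sup>*\<close> for the conjugate reciprocal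
\<open>z^n cnj (P (1 / cnj z))\<close>. If \<open>P\<close> has no zeros in the open disc, then \<open>F = T[P]\<close> and
\<open>H = (T[P\<^sup>*])\<^sup>*\<close> satisfy \<open>|F| \<le> |H|\<close> on the circle. For \<open>|w| = 1\<close> the polynomial \<open>F + w H\<close> is the
image of \<open>P\<close> under the multiplier \<open>g k + w cnj (g (n - k))\<close>, which is again admissible
because \<open>|g 0| < |g n|\<close>, so its mean is at most \<open>|g n + w cnj (g 0)|\<close> times that of \<open>P\<close>. Averaging
over \<open>w\<close>, the left side is at least \<open>\<parallel>1 + z\<parallel> \<parallel>F\<parallel>\<close> since \<open>|F| \<le> |H|\<close>, and the right side becomes
\<open>\<parallel>g n z + g 0\<parallel> \<parallel>P\<parallel>\<close>. Equality for \<open>a z^n + b\<close> is a computation: \<open>T\<close> maps it to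
\<open>g n a z^n + g 0 b\<close>, and the modulus of a binomial is distributed on the circle like that of a
linear polynomial with coefficients of the same moduli.
\<close>

section \<open>Polynomials with all zeros in the closed unit disc\<close>

definition disc_zeros :: "nat \<Rightarrow> complex poly \<Rightarrow> bool" where
  "disc_zeros n P \<longleftrightarrow> degree P = n \<and> (\<forall>z. poly P z = 0 \<longrightarrow> cmod z \<le> 1)"

lemma disc_zerosI:
  assumes "degree P \<le> n" "coeff P n \<noteq> 0" "\<And>z. cmod z > 1 \<Longrightarrow> poly P z \<noteq> 0"
  shows "disc_zeros n P"
  unfolding disc_zeros_def
  using assms by (metis le_degree linorder_not_less order_antisym)

lemma disc_zeros_nonzero: "disc_zeros n P \<Longrightarrow> P \<noteq> 0"
  by (auto simp: disc_zeros_def dest: spec[of _ 2])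

lemma disc_zeros_coeff: "disc_zeros n P \<Longrightarrow> coeff P n \<noteq> 0"
  using disc_zeros_nonzero by (auto simp: disc_zeros_def)

lemma disc_zeros_outside: "disc_zeros n P \<Longrightarrow> cmod z > 1 \<Longrightarrow> poly P z \<noteq> 0"
  by (auto simp: disc_zeros_def)

lemma poly_linear_factors:
  fixes P :: "complex poly"
  obtains r where "P = smult (lead_coeff P) (\<Prod>i<degree P. [:- r i, 1:])"
    "\<And>z. poly P z = lead_coeff P * (\<Prod>i<degree P. z - r i)"
proof -
  obtain r where r: "smult (lead_coeff P) (\<Prod>i<degree P. [:- r i, 1:]) = P"
    by (rule complex_poly_decompose')
  have "poly P z = lead_coeff P * (\<Prod>i<degree P. z - r i)" for z
    by (subst r[symmetric], subst poly_smult) (simp add: poly_prod)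
  with r that show thesis by metis
qed

lemma disc_zeros_factors:
  assumes "disc_zeros n P"
  obtains c r where "c \<noteq> 0" "c = coeff P n" "P = smult c (\<Prod>i<n. [:- r i, 1:])"
    "\<And>i. i < n \<Longrightarrow> cmod (r i) \<le> 1" "\<And>z. poly P z = c * (\<Prod>i<n. z - r i)"
proof -
  obtain r where r: "P = smult (lead_coeff P) (\<Prod>i<degree P. [:- r i, 1:])"
    and p: "\<And>z. poly P z = lead_coeff P * (\<Prod>i<degree P. z - r i)"
    by (rule poly_linear_factors[of P]) blast
  have d: "degree P = n" using assms by (simp add: disc_zeros_def)
  have "cmod (r i) \<le> 1" if "i < n" for i
  proof -
    have "poly P (r i) = 0" unfolding p d using that by (auto simp: prod_zero_iff)
    then show ?thesis using assms by (simp add: disc_zeros_def)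
  qed
  then show thesis using r p d disc_zeros_coeff[OF assms] that by metis
qed

lemma norm_diff_sq_identity:
  fixes a z :: complex
  shows "(cmod (z - a))\<^sup>2 - (cmod (1 - a * cnj z))\<^sup>2 = ((cmod z)\<^sup>2 - 1) * (1 - (cmod a)\<^sup>2)"
  by (simp only: cmod_power2, simp, simp add: power2_eq_square algebra_simps)

lemma norm_reflect_le:
  assumes "cmod z \<ge> 1" "cmod a \<le> 1"
  shows "cmod (1 - a * cnj z) \<le> cmod (z - a)"
proof -
  have "((cmod z)\<^sup>2 - 1) * (1 - (cmod a)\<^sup>2) \<ge> 0"
    using assms by (intro mult_nonneg_nonneg) (auto simp: power_le_one)
  then have "(cmod (1 - a * cnj z))\<^sup>2 \<le> (cmod (z - a))\<^sup>2"
    using norm_diff_sq_identity[of z a] by linarith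
  then show ?thesis by (rule power2_le_imp_le) simp
qed

text \<open>
At a point \<open>z\<close> outside the disc, comparing a linear factor with its reflection in the circle decides
on which side of the circle the zero \<open>a\<close> lies. The convexity argument in Laguerre's theorem and the
reflection of zeros into the disc both depend on this.
\<close>

lemma norm_reflect_le_iff:
  assumes "cmod z > 1"
  shows "cmod (1 - a * cnj z) \<le> cmod (z - a) \<longleftrightarrow> cmod a \<le> 1"
proof
  assume "cmod (1 - a * cnj z) \<le> cmod (z - a)"
  then have "(cmod (1 - a * cnj z))\<^sup>2 \<le> (cmod (z - a))\<^sup>2" by (intro power_mono) auto
  then have "((cmod z)\<^sup>2 - 1) * (1 - (cmod a)\<^sup>2) \<ge> 0"
    using norm_diff_sq_identity[of z a] by linarith
  moreover have "(cmod z)\<^sup>2 > 1" using assms by (simp add: one_less_power)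
  ultimately have "(cmod a)\<^sup>2 \<le> 1" by (simp add: zero_le_mult_iff)
  then show "cmod a \<le> 1" by (simp add: power2_le_iff_abs_le abs_square_le_1)
qed (use assms norm_reflect_le in auto)

text \<open>
The map \<open>a \<mapsto> 1 / (w - a)\<close> carries the closed unit disc onto another closed disc as long as its pole \<open>w\<close>
is outside. What matters is that the image is convex.
\<close>

lemma reciprocal_disc:
  assumes "cmod w > 1" "v \<noteq> 0"
  shows "cmod (v - cnj w / of_real ((cmod w)\<^sup>2 - 1)) \<le> 1 / ((cmod w)\<^sup>2 - 1)
    \<longleftrightarrow> cmod (w - 1 / v) \<le> 1"
proof -
  define d where "d = (cmod w)\<^sup>2 - 1"
  define a where "a = w - 1 / v"
  have d: "d > 0" using assms by (simp add: d_def one_less_power)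
  have dc: "complex_of_real d = w * cnj w - 1"
    by (simp add: d_def complex_norm_square del: of_real_power)
  have wa: "w - a = 1 / v" "w - a \<noteq> 0" using assms by (auto simp: a_def)
  have v: "v = 1 / (w - a)" using wa by simp
  have "v - cnj w / of_real d = (of_real d - (w - a) * cnj w) / ((w - a) * of_real d)"
    using d wa(2) by (simp add: v field_simps)
  also have "of_real d - (w - a) * cnj w = - (1 - a * cnj w)"
    by (simp add: dc algebra_simps)
  finally have eq: "cmod (v - cnj w / of_real d) = cmod (1 - a * cnj w) / (cmod (w - a) * d)"
    using d by (simp add: norm_divide norm_mult del: minus_diff_eq)
  have "cmod (v - cnj w / of_real d) \<le> 1 / d \<longleftrightarrow> cmod (1 - a * cnj w) \<le> cmod (w - a)"
    unfolding eq using d wa(2) by (simp add: field_simps)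
  then show ?thesis using norm_reflect_le_iff[OF assms(1), of a] by (simp add: d_def a_def)
qed

lemma log_derivative_linear_factors:
  fixes r :: "nat \<Rightarrow> complex"
  assumes "\<And>i. i < n \<Longrightarrow> z \<noteq> r i"
  shows "poly (pderiv (\<Prod>i<n. [:- r i, 1:])) z = (\<Prod>i<n. z - r i) * (\<Sum>i<n. 1 / (z - r i))"
  using assms
proof (induction n)
  case (Suc n)
  have "z - r n \<noteq> 0" using Suc.prems by simp
  define Q where "Q = (\<Prod>i<n. [:- r i, 1:])"
  have Q: "poly Q z = (\<Prod>i<n. z - r i)" by (simp add: Q_def poly_prod)
  have IH: "poly (pderiv Q) z = poly Q z * (\<Sum>i<n. 1 / (z - r i))"
    unfolding Q unfolding Q_def using Suc by simp
  have "poly (pderiv (Q * [:- r n, 1:])) z = poly Q z + (z - r n) * poly (pderiv Q) z"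
    by (subst pderiv_mult) (simp add: pderiv_pCons algebra_simps)
  also have "\<dots> = poly Q z * (z - r n) * ((\<Sum>i<n. 1 / (z - r i)) + 1 / (z - r n))"
    unfolding IH using \<open>z - r n \<noteq> 0\<close> by (simp add: field_simps)
  finally show ?case by (simp add: Q_def[symmetric] Q)
qed simp

text \<open>
The second coefficient from the top is needed to see that a polar derivative does not drop its
degree by more than one.
\<close>

lemma coeff_linear_factors:
  fixes r :: "nat \<Rightarrow> complex"
  shows "degree (\<Prod>i<n. [:- r i, 1:]) = n \<and> coeff (\<Prod>i<n. [:- r i, 1:]) n = 1
    \<and> coeff (\<Prod>i<Suc n. [:- r i, 1:]) n = - (\<Sum>i<Suc n. r i)"
proof (induction n)
  case (Suc n)
  have 1: "degree (\<Prod>i<m. [:- r i, 1:]) = m" for m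
    by (subst degree_prod_sum_eq) auto
  have 2: "coeff (\<Prod>i<m. [:- r i, 1:]) m = 1" for m
    using lead_coeff_prod[of "\<lambda>i. [:- r i, 1:]" "{..<m}"] by (simp add: 1)
  have "coeff (\<Prod>i<Suc (Suc n). [:- r i, 1:]) (Suc n) =
     - r (Suc n) * coeff (\<Prod>i<Suc n. [:- r i, 1:]) (Suc n) + coeff (\<Prod>i<Suc n. [:- r i, 1:]) n"
    by (subst prod.lessThan_Suc) (simp add: mult.commute[of _ "[:- r (Suc n), 1:]"] del: prod.lessThan_Suc)
  then show ?case using Suc 1 2 by (simp del: prod.lessThan_Suc)
qed simp

section \<open>Polar derivatives and the operators \<open>B\<close>\<close>

text \<open>
The polar derivative \<open>n P + (\<xi> - z) P'\<close> with pole \<open>\<xi> = y / x\<close>, in homogeneous coordinates so that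
\<open>x = 0\<close> gives the ordinary derivative, whose pole is at infinity.
\<close>

definition polar :: "complex \<Rightarrow> complex \<Rightarrow> nat \<Rightarrow> complex poly \<Rightarrow> complex poly" where
  "polar x y n P = smult x (smult (of_nat n) P - pCons 0 (pderiv P)) + smult y (pderiv P)"

lemma coeff_pCons_pderiv: "coeff (pCons 0 (pderiv P)) k = of_nat k * coeff P k"
  by (cases k) (auto simp: coeff_pderiv)

text \<open>
Laguerre's theorem, for a pole outside the closed disc. At a zero \<open>w\<close> of the polar derivative with
\<open>|w| > 1\<close>, the logarithmic derivative of \<open>P\<close> at \<open>w\<close> says that the mean \<open>v\<close> of the numbers
\<open>1 / (w - r i)\<close>, \<open>r i\<close> the zeros of \<open>P\<close>, solves \<open>x + (y - x w) v = 0\<close>. By convexity \<open>v\<close> is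
itself \<open>1 / (w - a)\<close> for some \<open>a\<close> in the disc, and then \<open>y = x a\<close> puts the pole into the disc.
\<close>

lemma Laguerre_polar:
  assumes P: "disc_zeros (Suc m) P" and xy: "cmod x < cmod y"
  shows "disc_zeros m (polar x y (Suc m) P)"
proof -
  obtain c r where c: "c \<noteq> 0" "c = coeff P (Suc m)" "P = smult c (\<Prod>i<Suc m. [:- r i, 1:])"
    and r: "\<And>i. i < Suc m \<Longrightarrow> cmod (r i) \<le> 1" and Pz: "\<And>z. poly P z = c * (\<Prod>i<Suc m. z - r i)"
    by (rule disc_zeros_factors[OF P]) blast
  have dP: "degree P = Suc m" using P by (simp add: disc_zeros_def)
  have coeff: "coeff (polar x y (Suc m) P) k
      = x * (of_nat (Suc m) - of_nat k) * coeff P k + y * of_nat (Suc k) * coeff P (Suc k)" for k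
    by (simp add: polar_def coeff_pCons_pderiv coeff_pderiv algebra_simps)
  show ?thesis
  proof (rule disc_zerosI)
    show "degree (polar x y (Suc m) P) \<le> m"
    proof (rule degree_le, intro allI impI)
      fix k assume "m < k"
      then have "k = Suc m \<or> Suc m < k" by auto
      then show "coeff (polar x y (Suc m) P) k = 0"
        unfolding coeff using coeff_eq_0[of P] dP by auto
    qed
  next
    have Pm: "coeff P m = - c * (\<Sum>i<Suc m. r i)"
      by (subst c(3)) (use coeff_linear_factors[of r m] in \<open>simp del: prod.lessThan_Suc sum.lessThan_Suc\<close>)
    have "coeff (polar x y (Suc m) P) m = c * (y * of_nat (Suc m) - x * (\<Sum>i<Suc m. r i))"
      unfolding coeff Pm c(2)[symmetric] by (simp add: algebra_simps)
    moreover have "cmod (x * (\<Sum>i<Suc m. r i)) < cmod (y * of_nat (Suc m))"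
    proof -
      have "cmod (\<Sum>i<Suc m. r i) \<le> (\<Sum>i<Suc m. 1)"
        by (rule sum_norm_le) (use r in auto)
      then have "cmod (\<Sum>i<Suc m. r i) \<le> real (Suc m)" by simp
      then have "cmod x * cmod (\<Sum>i<Suc m. r i) \<le> cmod x * real (Suc m)"
        by (rule mult_left_mono) simp
      also have "\<dots> < cmod y * real (Suc m)" using xy by simp
      finally show ?thesis by (simp only: norm_mult norm_of_nat)
    qed
    ultimately show "coeff (polar x y (Suc m) P) m \<noteq> 0" using c(1) by auto
  next
    fix w :: complex assume w: "cmod w > 1"
    have wr: "w \<noteq> r i" if "i < Suc m" for i using r[OF that] w by auto
    have Pw: "poly P w \<noteq> 0" using disc_zeros_outside[OF P w] .
    define v where "v = (\<Sum>i<Suc m. (1 / real (Suc m)) *\<^sub>R (1 / (w - r i)))"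
    let ?K = "cball (cnj w / of_real ((cmod w)\<^sup>2 - 1)) (1 / ((cmod w)\<^sup>2 - 1))"
    \<comment> \<open>The logarithmic derivative is a sum of points of this disc, so its mean stays in it.\<close>
    have vK: "v \<in> ?K" unfolding v_def
    proof (rule convex_sum)
      fix i assume "i \<in> {..<Suc m}"
      then have "cmod (w - 1 / (1 / (w - r i))) \<le> 1" using r by simp
      then show "1 / (w - r i) \<in> ?K"
        using reciprocal_disc[OF w, of "1 / (w - r i)"] wr[of i] \<open>i \<in> _\<close>
        by (auto simp: dist_norm norm_minus_commute)
    qed auto
    have "poly (pderiv P) w = poly P w * (\<Sum>i<Suc m. 1 / (w - r i))"
      using log_derivative_linear_factors[of "Suc m" w r] wr
      by (subst c(3)) (simp add: pderiv_smult Pz del: prod.lessThan_Suc sum.lessThan_Suc)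
    also have "(\<Sum>i<Suc m. 1 / (w - r i)) = of_nat (Suc m) * v"
      unfolding v_def scaleR_sum_right[symmetric]
      by (simp add: scaleR_conv_of_real del: sum.lessThan_Suc of_nat_Suc)
    finally have P': "poly (pderiv P) w = of_nat (Suc m) * v * poly P w" by (simp add: mult_ac)
    have pw: "poly (polar x y (Suc m) P) w = of_nat (Suc m) * poly P w * (x + (y - x * w) * v)"
      by (simp add: polar_def P' algebra_simps)
    show "poly (polar x y (Suc m) P) w \<noteq> 0"
    proof
      assume "poly (polar x y (Suc m) P) w = 0"
      then have 0: "x + (y - x * w) * v = 0" unfolding pw using Pw
        by (metis mult_eq_0_iff of_nat_eq_0_iff nat.distinct(1))
      have d: "(cmod w)\<^sup>2 - 1 > 0" using w by (simp add: one_less_power)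
      \<comment> \<open>The disc avoids \<open>0\<close>: its centre has modulus \<open>|w|\<close> times its radius.\<close>
      have v0: "v \<noteq> 0"
      proof
        assume "v = 0"
        then have "cmod w / ((cmod w)\<^sup>2 - 1) \<le> 1 / ((cmod w)\<^sup>2 - 1)"
          using vK d by (simp add: norm_divide del: of_real_diff of_real_power)
        then show False using d w by (simp add: divide_le_cancel)
      qed
      have "y = x * (w - 1 / v)" using 0 v0 by (simp add: field_simps)
      moreover have "cmod (w - 1 / v) \<le> 1"
        using vK reciprocal_disc[OF w v0] by (simp add: dist_norm norm_minus_commute)
      ultimately have "cmod y \<le> cmod x" by (simp add: norm_mult mult_left_le)
      then show False using xy by simp
    qed
  qed
qed

text \<open>
Allowing constant factors covers the cases in which the degree is smaller than two.
\<close>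

lemma quadratic_split:
  fixes a b c :: complex
  obtains A1 B1 A2 B2 where "A1 * A2 = a" "A1 * B2 + A2 * B1 = b" "B1 * B2 = c"
proof (cases "c = 0")
  case True
  then show thesis using that[of a 1 0 b] by simp
next
  case False
  define d where "d = csqrt (b\<^sup>2 - 4 * a * c)"
  have d: "d * d = b * b - 4 * a * c" by (simp add: d_def power2_eq_square[symmetric])
  show thesis
  proof (rule that)
    have "(- c * ((- b + d) / (2 * c))) * (- ((- b - d) / (2 * c))) = (b * b - d * d) / (4 * c)"
      using False by (simp add: field_simps)
    also have "\<dots> = a" unfolding d using False by (simp add: field_simps)
    finally show "(- c * ((- b + d) / (2 * c))) * (- ((- b - d) / (2 * c))) = a" .
    show "(- c * ((- b + d) / (2 * c))) * 1 + (- ((- b - d) / (2 * c))) * c = b"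
      using False by (simp add: field_simps)
    show "c * 1 = c" by simp
  qed
qed

text \<open>
The eigenvalue of \<open>B\<close> on \<open>z^k\<close>.
\<close>

definition B_symbol :: "nat \<Rightarrow> complex \<Rightarrow> complex \<Rightarrow> complex \<Rightarrow> nat \<Rightarrow> complex" where
  "B_symbol n l0 l1 l2 k = l0 + l1 * (of_nat n / 2) * of_nat k
     + l2 * (of_nat n / 2)\<^sup>2 * (of_nat k * (of_nat k - 1) / 2)"

lemma poly_B_op:
  "poly (B_op n l0 l1 l2 P) z = l0 * poly P z + l1 * (of_nat n * z / 2) * poly (pderiv P) z
     + l2 * (of_nat n * z / 2)\<^sup>2 * (poly (pderiv (pderiv P)) z / 2)"
  by (simp add: B_op_def power2_eq_square field_simps)

lemma coeff_B_op: "coeff (B_op n l0 l1 l2 P) k = B_symbol n l0 l1 l2 k * coeff P k"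
proof -
  have 2: "coeff (pCons 0 (pCons 0 (pderiv (pderiv P)))) k = of_nat k * (of_nat k - 1) * coeff P k"
    by (cases k; cases "k - 1") (auto simp: coeff_pderiv algebra_simps)
  have "B_op n l0 l1 l2 P = smult l0 P + smult (l1 * (of_nat n / 2)) (pCons 0 (pderiv P))
      + smult (l2 * (of_nat n / 2)\<^sup>2 / 2) (pCons 0 (pCons 0 (pderiv (pderiv P))))"
    by (simp add: B_op_def power2_eq_square mult.assoc)
  then show ?thesis
    unfolding B_symbol_def
    by (simp only: coeff_add coeff_smult coeff_pCons_pderiv 2) (simp add: algebra_simps)
qed

lemma poly_U: "poly (U_poly n l0 l1 l2) z = l0 + l1 * of_nat n * z + l2 * (of_nat n * (of_nat n - 1) / 2) * z\<^sup>2"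
proof -
  have eq: "of_nat (n choose 2) = (of_nat n * (of_nat n - 1) / 2 :: complex)"
    by (simp add: binomial_gbinomial gbinomial_prod_rev numeral_2_eq_2)
  show ?thesis unfolding U_poly_def eq by (simp add: power2_eq_square algebra_simps)
qed

text \<open>
Split \<open>U(z) = (A1 + B1 z) (A2 + B2 z)\<close>. The condition on the zeros of \<open>U\<close> gives
\<open>|Aj| \<le> |Aj + Bj n / 2| \<noteq> 0\<close>, so for \<open>|w| > 1\<close> the poles \<open>w (Aj + Bj n / 2) / Aj\<close> lie outside the
closed disc. Taking both polar derivatives of \<open>P\<close> and evaluating at the same point \<open>w\<close> yields
\<open>n (n - 1) B[P](w)\<close>. For \<open>n = 1\<close> this factor vanishes, but then \<open>P'' = 0\<close> and one polar derivative
suffices.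
\<close>

lemma B_op_disc_zeros_outside:
  assumes n: "n \<ge> 1" and B: "B_class_params n l0 l1 l2"
    and P: "disc_zeros n P" and w: "cmod w > 1"
  shows "poly (B_op n l0 l1 l2 P) w \<noteq> 0"
proof -
  obtain A1 B1 A2 B2 where
    AB: "A1 * A2 = l0" "A1 * B2 + A2 * B1 = l1 * of_nat n" "B1 * B2 = l2 * (of_nat n * (of_nat n - 1) / 2)"
    by (rule quadratic_split)
  have U: "poly (U_poly n l0 l1 l2) z = (A1 + B1 * z) * (A2 + B2 * z)" for z
    unfolding poly_U AB[symmetric] by (simp add: power2_eq_square algebra_simps)
  have factor: "cmod A < cmod (w * (A + B * (of_nat n / 2)))"
    if "\<And>z. A + B * z = 0 \<Longrightarrow> poly (U_poly n l0 l1 l2) z = 0" for A B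
  proof -
    have z: "cmod z \<le> cmod (z - of_nat n / 2)" if "A + B * z = 0" for z
      using B \<open>\<And>z. A + B * z = 0 \<Longrightarrow> _\<close> that by (auto simp: B_class_params_def)
    have nz: "\<not> A + B * (of_nat n / 2) = 0" using z[of "of_nat n / 2"] n by auto
    have "cmod A \<le> cmod (A + B * (of_nat n / 2))"
    proof (cases "B = 0")
      case False
      have "cmod (- A / B) \<le> cmod (- A / B - of_nat n / 2)" by (rule z) (use False in simp)
      then have "cmod B * cmod (- A / B) \<le> cmod B * cmod (- A / B - of_nat n / 2)"
        by (rule mult_left_mono) simp
      also have "\<dots> = cmod (B * (- A / B - of_nat n / 2))" by (simp only: norm_mult)
      also have "B * (- A / B - of_nat n / 2) = - (A + B * (of_nat n / 2))"
        using False by (simp add: field_simps)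
      finally show ?thesis using False by (simp only: norm_minus_cancel) (simp add: norm_divide)
    qed simp
    moreover have "cmod (A + B * (of_nat n / 2)) > 0" using nz by simp
    ultimately show ?thesis
      using mult_strict_right_mono[OF w, of "cmod (A + B * (of_nat n / 2))"]
      unfolding norm_mult by linarith
  qed
  have f1: "cmod A1 < cmod (w * (A1 + B1 * (of_nat n / 2)))" by (rule factor) (simp add: U)
  have f2: "cmod A2 < cmod (w * (A2 + B2 * (of_nat n / 2)))" by (rule factor) (simp add: U)
  show ?thesis
  proof (cases "n = 1")
    case True
    have "cmod l0 < cmod (w * (l0 + l1 * (of_nat n / 2)))"
      by (rule factor) (simp add: poly_U True)
    then have "disc_zeros 0 (polar l0 (w * (l0 + l1 * (of_nat n / 2))) (Suc 0) P)"
      using P True by (intro Laguerre_polar) auto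
    from disc_zeros_outside[OF this w] have
      "poly (polar l0 (w * (l0 + l1 * (of_nat n / 2))) (Suc 0) P) w \<noteq> 0" .
    moreover have "pderiv (pderiv P) = 0"
      using P True by (intro poly_eqI) (simp add: coeff_pderiv disc_zeros_def coeff_eq_0)
    ultimately show ?thesis by (simp add: poly_B_op polar_def True algebra_simps)
  next
    case False
    then obtain m where m: "n = Suc (Suc m)" using n by (metis One_nat_def Suc_le_D not0_implies_Suc)
    define y1 where "y1 = w * (A1 + B1 * (of_nat n / 2))"
    define y2 where "y2 = w * (A2 + B2 * (of_nat n / 2))"
    have "disc_zeros (Suc m) (polar A1 y1 n P)"
      using P f1 unfolding m y1_def by (intro Laguerre_polar)
    then have "disc_zeros m (polar A2 y2 (Suc m) (polar A1 y1 n P))"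
      using f2 unfolding y2_def by (intro Laguerre_polar)
    from disc_zeros_outside[OF this w]
    have nz: "poly (polar A2 y2 (Suc m) (polar A1 y1 n P)) w \<noteq> 0" .
    define p p' p'' where "p = poly P w" and "p' = poly (pderiv P) w" and "p'' = poly (pderiv (pderiv P)) w"
    define N where "N = (of_nat n :: complex)"
    have N: "of_nat (Suc m) = N - 1" by (simp add: N_def m)
    have e1: "poly (polar A1 y1 n P) w = A1 * N * p + w * B1 * (N / 2) * p'"
      by (simp add: polar_def p_def p'_def y1_def N_def algebra_simps)
    have e2: "poly (pderiv (polar A1 y1 n P)) w = A1 * (N - 1) * p' + w * B1 * (N / 2) * p''"
      by (simp add: polar_def pderiv_add pderiv_smult pderiv_diff pderiv_pCons p_def p'_def p''_def y1_def N_def algebra_simps)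
    have "poly (polar A2 y2 (Suc m) (polar A1 y1 n P)) w =
       A2 * (N - 1) * poly (polar A1 y1 n P) w + w * B2 * (N / 2) * poly (pderiv (polar A1 y1 n P)) w"
      by (subst polar_def) (simp only: poly_add poly_smult poly_diff poly_pCons N, simp add: y2_def N_def algebra_simps)
    also have "\<dots> = (N * (N - 1)) * (A1 * A2) * p + (N - 1) * (A1 * B2 + A2 * B1) * (N * w / 2) * p'
        + (B1 * B2) * (N * w / 2)\<^sup>2 * p''"
      unfolding e1 e2 by (simp add: power2_eq_square field_simps)
    also have "\<dots> = N * (N - 1) * poly (B_op n l0 l1 l2 P) w"
      unfolding AB poly_B_op by (simp add: N_def p_def p'_def p''_def power2_eq_square field_simps)
    finally show ?thesis using nz by auto
  qed
qed

lemma B_symbol_n: "B_symbol n l0 l1 l2 n = Lambda n l0 l1 l2"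
  by (simp add: B_symbol_def Lambda_def power2_eq_square power3_eq_cube field_simps)

lemma B_symbol_0: "B_symbol n l0 l1 l2 0 = l0"
  by (simp add: B_symbol_def)

text \<open>
Since \<open>\<Lambda>\<^sub>n = U(n / 2)\<close> and \<open>\<lambda>\<^sub>0 = U(0)\<close>, this is the product over the zeros of \<open>U\<close> of the
hypothesis that each of them is at least as close to \<open>0\<close> as to \<open>n / 2\<close>.
\<close>

lemma Lambda_dominates:
  assumes n: "n \<ge> 1" and B: "B_class_params n l0 l1 l2"
  shows "Lambda n l0 l1 l2 \<noteq> 0 \<and> cmod l0 \<le> cmod (Lambda n l0 l1 l2)"
proof -
  define U where "U = U_poly n l0 l1 l2"
  have L: "Lambda n l0 l1 l2 = poly U (of_nat n / 2)"
    by (simp add: U_def poly_U Lambda_def power2_eq_square power3_eq_cube field_simps)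
  have l0: "l0 = poly U 0" by (simp add: U_def poly_U)
  have root: "cmod z \<le> cmod (z - of_nat n / 2)" if "poly U z = 0" for z
    using B that by (auto simp: B_class_params_def U_def)
  obtain r where r: "\<And>z. poly U z = lead_coeff U * (\<Prod>i<degree U. z - r i)"
    by (rule poly_linear_factors[of U]) blast
  have "poly U (r i) = 0" if "i < degree U" for i
    unfolding r using that by (auto simp: prod_zero_iff)
  then have "(\<Prod>i<degree U. cmod (0 - r i)) \<le> (\<Prod>i<degree U. cmod (of_nat n / 2 - r i))"
    using root by (intro prod_mono) (auto simp: norm_minus_commute)
  then have "cmod (poly U 0) \<le> cmod (poly U (of_nat n / 2))"
    unfolding r norm_mult prod_norm[symmetric] by (intro mult_left_mono) auto
  moreover have "poly U (of_nat n / 2) \<noteq> 0" using root[of "of_nat n / 2"] n by auto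
  ultimately show ?thesis by (simp add: L l0[symmetric])
qed

section \<open>Coefficient multipliers that keep zeros in the disc\<close>

definition multiplier :: "nat \<Rightarrow> (nat \<Rightarrow> complex) \<Rightarrow> complex poly \<Rightarrow> complex poly" where
  "multiplier n g P = (\<Sum>k\<le>n. monom (g k * coeff P k) k)"

definition admissible :: "nat \<Rightarrow> (nat \<Rightarrow> complex) \<Rightarrow> bool" where
  "admissible n g \<longleftrightarrow> (\<forall>P. disc_zeros n P \<longrightarrow> disc_zeros n (multiplier n g P))"

text \<open>
The polynomial \<open>z^n cnj (P (1 / cnj z))\<close>; the formal degree \<open>n\<close> is a parameter, as \<open>P\<close> may have
smaller degree.
\<close>

definition conj_reciprocal :: "nat \<Rightarrow> complex poly \<Rightarrow> complex poly" where
  "conj_reciprocal n P = (\<Sum>k\<le>n. monom (cnj (coeff P (n - k))) k)"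

lemma coeff_multiplier: "coeff (multiplier n g P) k = (if k \<le> n then g k * coeff P k else 0)"
  by (simp add: multiplier_def coeff_sum coeff_monom if_distrib sum.delta' cong: if_cong)

lemma coeff_conj_reciprocal:
  "coeff (conj_reciprocal n P) k = (if k \<le> n then cnj (coeff P (n - k)) else 0)"
  by (simp add: conj_reciprocal_def coeff_sum coeff_monom if_distrib sum.delta' cong: if_cong)

lemma degree_multiplier: "degree (multiplier n g P) \<le> n"
  by (rule degree_le) (simp add: coeff_multiplier)

lemma degree_conj_reciprocal: "degree (conj_reciprocal n P) \<le> n"
  by (rule degree_le) (simp add: coeff_conj_reciprocal)

lemma multiplier_add: "multiplier n g (P + Q) = multiplier n g P + multiplier n g Q"
  by (rule poly_eqI) (simp add: coeff_multiplier algebra_simps)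

lemma multiplier_smult: "multiplier n g (smult c P) = smult c (multiplier n g P)"
  by (rule poly_eqI) (simp add: coeff_multiplier algebra_simps)

lemma multiplier_monom: "multiplier n g (monom c n) = monom (g n * c) n"
  by (rule poly_eqI) (simp add: coeff_multiplier)

lemma conj_reciprocal_twice: "degree P \<le> n \<Longrightarrow> conj_reciprocal n (conj_reciprocal n P) = P"
  by (rule poly_eqI) (simp add: coeff_conj_reciprocal coeff_eq_0)

lemma poly_degree_le:
  fixes P :: "complex poly"
  assumes "degree P \<le> n"
  shows "poly P z = (\<Sum>i\<le>n. coeff P i * z ^ i)"
  unfolding poly_altdef
  by (rule sum.mono_neutral_left) (use assms in \<open>auto simp: coeff_eq_0\<close>)

lemma poly_conj_reciprocal:
  assumes "degree P \<le> n" "z \<noteq> 0"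
  shows "poly (conj_reciprocal n P) z = z ^ n * cnj (poly P (1 / cnj z))"
proof -
  have "poly (conj_reciprocal n P) z = (\<Sum>i\<le>n. cnj (coeff P (n - i)) * z ^ i)"
    by (simp add: poly_degree_le[OF degree_conj_reciprocal] coeff_conj_reciprocal)
  also have "\<dots> = (\<Sum>i\<le>n. cnj (coeff P i) * z ^ (n - i))"
    by (rule sum.reindex_bij_witness[of _ "\<lambda>i. n - i" "\<lambda>i. n - i"]) auto
  also have "\<dots> = (\<Sum>i\<le>n. z ^ n * (cnj (coeff P i) * (1 / z) ^ i))"
    using assms(2) by (intro sum.cong) (auto simp: power_diff power_one_over field_simps)
  also have "\<dots> = z ^ n * cnj (poly P (1 / cnj z))"
    by (simp add: poly_degree_le[OF assms(1)] sum_distrib_left)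
  finally show ?thesis .
qed

lemma norm_conj_reciprocal_circle:
  assumes "degree P \<le> n" "cmod z = 1"
  shows "cmod (poly (conj_reciprocal n P) z) = cmod (poly P z)"
proof -
  have z: "z \<noteq> 0" using assms(2) by auto
  have "z * cnj z = 1" using assms(2) by (simp add: complex_norm_square[symmetric])
  then have "1 / cnj z = z" using z by (metis complex_cnj_zero_iff nonzero_eq_divide_eq)
  then show ?thesis using assms by (simp add: poly_conj_reciprocal[OF assms(1) z] norm_mult norm_power)
qed

lemma norm_conj_reciprocal_outside:
  assumes P: "disc_zeros n P" and z: "cmod z \<ge> 1"
  shows "cmod (poly (conj_reciprocal n P) z) \<le> cmod (poly P z)"
proof -
  obtain c r where r: "\<And>i. i < n \<Longrightarrow> cmod (r i) \<le> 1" and Pz: "\<And>z. poly P z = c * (\<Prod>i<n. z - r i)"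
    by (rule disc_zeros_factors[OF P]) blast
  have z0: "z \<noteq> 0" using z by auto
  have factor: "cmod z * cmod (1 / cnj z - r i) = cmod (1 - r i * cnj z)" for i
  proof -
    have "cmod z * cmod (1 / cnj z - r i) = cmod (cnj z * (1 / cnj z - r i))" by (simp add: norm_mult)
    also have "cnj z * (1 / cnj z - r i) = 1 - r i * cnj z" using z0 by (simp add: field_simps)
    finally show ?thesis .
  qed
  have "cmod (poly (conj_reciprocal n P) z) = cmod z ^ n * cmod (poly P (1 / cnj z))"
    using P by (simp add: poly_conj_reciprocal z0 disc_zeros_def norm_mult norm_power)
  also have "\<dots> = cmod c * (\<Prod>i<n. cmod z * cmod (1 / cnj z - r i))"
    by (simp only: prod.distrib prod_constant card_lessThan) (simp add: Pz norm_mult prod_norm[symmetric])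
  also have "\<dots> \<le> cmod c * (\<Prod>i<n. cmod (z - r i))"
    unfolding factor using norm_reflect_le[OF z] r by (intro mult_left_mono prod_mono) auto
  also have "\<dots> = cmod (poly P z)" by (simp add: Pz norm_mult prod_norm[symmetric])
  finally show ?thesis .
qed

lemma poly_norm_le_limit:
  fixes F G :: "complex poly"
  assumes "s \<longlonglongrightarrow> x" "\<And>k::nat. cmod (poly F (s k)) \<le> cmod (poly G (s k))"
  shows "cmod (poly F x) \<le> cmod (poly G x)"
proof (rule LIMSEQ_le)
  show "(\<lambda>k. cmod (poly F (s k))) \<longlonglongrightarrow> cmod (poly F x)" "(\<lambda>k. cmod (poly G (s k))) \<longlonglongrightarrow> cmod (poly G x)"
    by (intro tendsto_norm tendsto_poly assms(1))+
qed (use assms(2) in auto)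

text \<open>
If the inequality failed for the images at an outer point \<open>w\<close>, then some \<open>c\<close> with \<open>|c| > 1\<close> would make the
image of \<open>F + c G\<close> vanish at \<open>w\<close>. But \<open>|F| \<le> |G| < |c G|\<close> outside the disc, so \<open>F + c G\<close> has all its
zeros in the disc, contradicting admissibility. The circle itself follows by continuity.
\<close>

lemma multiplier_dominated:
  assumes g: "admissible n g" and G: "disc_zeros n G" and F: "degree F \<le> n"
    and le: "\<And>z. cmod z > 1 \<Longrightarrow> cmod (poly F z) \<le> cmod (poly G z)" and z: "cmod z \<ge> 1"
  shows "cmod (poly (multiplier n g F) z) \<le> cmod (poly (multiplier n g G) z)"
proof -
  \<comment> \<open>The inequality at infinity, read off at \<open>0\<close> from the conjugate reciprocals.\<close>
  have lead: "cmod (coeff F n) \<le> cmod (coeff G n)"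
  proof -
    have "cmod (poly (conj_reciprocal n F) 0) \<le> cmod (poly (conj_reciprocal n G) 0)"
    proof (rule poly_norm_le_limit)
      show "(\<lambda>k. complex_of_real (inverse (real (Suc (Suc k))))) \<longlonglongrightarrow> 0"
        using tendsto_of_real[OF LIMSEQ_Suc[OF LIMSEQ_inverse_real_of_nat], where 'a = complex]
        by (simp only: of_real_0)
      fix k
      define x where "x = complex_of_real (inverse (real (Suc (Suc k))))"
      have u: "0 < inverse (real (Suc (Suc k)))" "inverse (real (Suc (Suc k))) < 1"
        by (auto simp: inverse_eq_divide divide_less_eq)
      then have "x \<noteq> 0" unfolding x_def of_real_eq_0_iff by linarith
      moreover have "cmod x = inverse (real (Suc (Suc k)))"
        unfolding x_def norm_of_real using u by simp
      ultimately have "x \<noteq> 0" "cmod (1 / cnj x) > 1"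
        using u by (simp_all add: norm_divide less_divide_eq del: of_nat_Suc)
      then show "cmod (poly (conj_reciprocal n F) x) \<le> cmod (poly (conj_reciprocal n G) x)"
        using F G le by (simp add: poly_conj_reciprocal disc_zeros_def norm_mult mult_left_mono)
    qed
    then show ?thesis by (simp add: poly_0_coeff_0 coeff_conj_reciprocal)
  qed
  have out: "cmod (poly (multiplier n g F) w) \<le> cmod (poly (multiplier n g G) w)" if w: "cmod w > 1" for w
  proof (rule ccontr)
    assume *: "\<not> cmod (poly (multiplier n g F) w) \<le> cmod (poly (multiplier n g G) w)"
    define c where "c = - poly (multiplier n g F) w / poly (multiplier n g G) w"
    have Gw: "poly (multiplier n g G) w \<noteq> 0"
      using g G disc_zeros_outside w unfolding admissible_def by blast
    have c: "cmod c > 1" using * Gw by (simp add: c_def norm_divide)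
    have strict: "f + c * h \<noteq> 0" if "cmod f \<le> cmod h" "h \<noteq> 0" for f h
    proof
      assume "f + c * h = 0"
      then have "cmod f = cmod c * cmod h" by (metis add_eq_0_iff2 norm_minus_cancel norm_mult)
      moreover have "cmod c * cmod h > 1 * cmod h" using c that(2) by (intro mult_strict_right_mono) auto
      ultimately show False using that(1) by simp
    qed
    have "disc_zeros n (F + smult c G)"
    proof (rule disc_zerosI)
      show "degree (F + smult c G) \<le> n" using F G by (intro degree_add_le) (auto simp: disc_zeros_def)
      show "coeff (F + smult c G) n \<noteq> 0" using strict[OF lead] disc_zeros_coeff[OF G] by simp
      show "poly (F + smult c G) z \<noteq> 0" if "cmod z > 1" for z
        using strict[OF le[OF that] disc_zeros_outside[OF G that]] by simp
    qed
    then have "poly (multiplier n g (F + smult c G)) w \<noteq> 0"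
      using g disc_zeros_outside w unfolding admissible_def by blast
    then show False using Gw
      by (simp only: multiplier_add multiplier_smult poly_add poly_smult) (simp add: c_def)
  qed
  show ?thesis
  proof (rule poly_norm_le_limit)
    have "(\<lambda>k. of_real (1 + inverse (real (Suc k))) * z) \<longlonglongrightarrow> of_real 1 * z"
      using LIMSEQ_inverse_real_of_nat_add[of 1] by (intro tendsto_intros)
    then show "(\<lambda>k. of_real (1 + inverse (real (Suc k))) * z) \<longlonglongrightarrow> z" by simp
    fix k
    have "cmod (of_real (1 + inverse (real (Suc k))) * z) = (1 + inverse (real (Suc k))) * cmod z"
      unfolding norm_mult norm_of_real by simp
    also have "\<dots> > 1 * cmod z" using z by (intro mult_strict_right_mono) auto
    finally have "cmod (of_real (1 + inverse (real (Suc k))) * z) > 1" using z by linarith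
    then show "cmod (poly (multiplier n g F) (of_real (1 + inverse (real (Suc k))) * z)) \<le> cmod (poly (multiplier n g G) (of_real (1 + inverse (real (Suc k))) * z))"
      by (rule out)
  qed
qed

text \<open>
This quantifies how little a linear factor with its zero outside the open disc can shrink when the
argument moves radially inwards. The constant tends to \<open>1\<close> with \<open>t\<close>, which is what the next lemma
needs to get past zeros of \<open>G\<close> on the circle.
\<close>

lemma shrink_factor:
  fixes z a :: complex
  assumes z: "cmod z = 1" and a: "cmod a \<ge> 1" and t: "0 \<le> t" "t \<le> 1"
  shows "(1 + t) * cmod (z - a) \<le> 2 * cmod (of_real t * z - a)"
proof (rule power2_le_imp_le)
  define s c where "s = cmod a" and "c = Re (z * cnj a)"
  have c: "- s \<le> c"
    using abs_Re_le_cmod[of "z * cnj a"] z by (simp add: s_def c_def norm_mult)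
  have z2: "(Re z)\<^sup>2 + (Im z)\<^sup>2 = 1" using z by (simp add: cmod_power2[symmetric])
  have a2: "s\<^sup>2 = (Re a)\<^sup>2 + (Im a)\<^sup>2" by (simp add: s_def cmod_power2)
  have n1: "(cmod (of_real u * z - a))\<^sup>2 = u\<^sup>2 - 2 * u * c + s\<^sup>2" for u
  proof -
    have "(cmod (of_real u * z - a))\<^sup>2 = u\<^sup>2 * ((Re z)\<^sup>2 + (Im z)\<^sup>2) - 2 * u * c + s\<^sup>2"
      unfolding a2 by (simp only: cmod_power2) (simp add: c_def power2_eq_square algebra_simps)
    then show ?thesis unfolding z2 by simp
  qed
  have "(2 * cmod (of_real t * z - a))\<^sup>2 - ((1 + t) * cmod (z - a))\<^sup>2
     = 4 * (t\<^sup>2 - 2 * t * c + s\<^sup>2) - (1 + t)\<^sup>2 * (1 - 2 * c + s\<^sup>2)"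
    using n1[of t] n1[of 1] by (simp add: power_mult_distrib)
  also have "\<dots> = 2 * (c + s) * (1 - t)\<^sup>2 + (1 - t) * ((s - 1) * ((3 + t) * s + (1 + 3 * t)))"
    by (simp add: power2_eq_square algebra_simps)
  also have "\<dots> \<ge> 0"
  proof -
    have "c + s \<ge> 0" "s \<ge> 1" using c a by (auto simp: s_def)
    then have "(s - 1) * ((3 + t) * s + (1 + 3 * t)) \<ge> 0" "2 * (c + s) * (1 - t)\<^sup>2 \<ge> 0"
      using t by auto
    then show ?thesis using t by simp
  qed
  finally show "((1 + t) * cmod (z - a))\<^sup>2 \<le> (2 * cmod (of_real t * z - a))\<^sup>2" by simp
qed simp

text \<open>
The quotient \<open>F / G\<close> may be undefined at zeros of \<open>G\<close> on the circle, so the maximum modulus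
principle is applied to \<open>F(z) / G(t z)\<close> with \<open>t < 1\<close>, and then \<open>t \<rightarrow> 1\<close>.
\<close>

lemma maximum_modulus_ratio:
  assumes G: "\<And>z. cmod z < 1 \<Longrightarrow> poly G z \<noteq> 0"
    and le: "\<And>z. cmod z = 1 \<Longrightarrow> cmod (poly F z) \<le> cmod (poly G z)" and z: "cmod z \<le> 1"
  shows "cmod (poly F z) \<le> cmod (poly G z)"
proof -
  obtain r where r: "\<And>z. poly G z = lead_coeff G * (\<Prod>i<degree G. z - r i)"
    by (rule poly_linear_factors[of G]) blast
  have r1: "cmod (r i) \<ge> 1" if "i < degree G" for i
  proof (rule ccontr)
    assume "\<not> cmod (r i) \<ge> 1"
    moreover have "poly G (r i) = 0" unfolding r using that by (auto simp: prod_zero_iff)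
    ultimately show False using G by auto
  qed
  have bound: "cmod (poly F z) \<le> (2 / (1 + t)) ^ degree G * cmod (poly G (of_real t * z))" if t: "0 \<le> t" "t < 1" for t
  proof -
    have nz: "poly G (of_real t * x) \<noteq> 0" if "cmod x \<le> 1" for x
    proof (rule G)
      have "t * cmod x \<le> t * 1" using t that by (intro mult_left_mono) auto
      then show "cmod (of_real t * x) < 1" using t by (simp add: norm_mult)
    qed
    have "cmod (poly F z / poly G (of_real t * z)) \<le> (2 / (1 + t)) ^ degree G"
    proof (rule maximum_modulus_frontier[where f="\<lambda>z. poly F z / poly G (of_real t * z)" and S="cball 0 1"])
      show "(\<lambda>z. poly F z / poly G (of_real t * z)) holomorphic_on interior (cball 0 1)"
        using nz by (intro holomorphic_intros) auto
      show "continuous_on (closure (cball 0 1)) (\<lambda>z. poly F z / poly G (of_real t * z))"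
        using nz by (intro continuous_intros) auto
      fix x :: complex assume "x \<in> frontier (cball 0 1)"
      then have x: "cmod x = 1" by (simp add: frontier_cball)
      have "cmod (poly F x) \<le> cmod (poly G x)" by (rule le[OF x])
      also have "\<dots> = cmod (lead_coeff G) * (\<Prod>i<degree G. cmod (x - r i))"
        by (simp add: r norm_mult prod_norm[symmetric])
      also have "\<dots> \<le> cmod (lead_coeff G) * (\<Prod>i<degree G. 2 / (1 + t) * cmod (of_real t * x - r i))"
      proof (intro mult_left_mono prod_mono conjI)
        fix i assume "i \<in> {..<degree G}"
        then show "cmod (x - r i) \<le> 2 / (1 + t) * cmod (of_real t * x - r i)"
          using shrink_factor[OF x r1, of i t] t by (simp add: field_simps)
      qed auto
      also have "\<dots> = (2 / (1 + t)) ^ degree G * cmod (poly G (of_real t * x))"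
        unfolding prod.distrib prod_constant card_lessThan
        by (simp add: r norm_mult prod_norm[symmetric] power_divide)
      finally show "cmod (poly F x / poly G (of_real t * x)) \<le> (2 / (1 + t)) ^ degree G"
        using nz[of x] x by (simp add: norm_divide pos_divide_le_eq)
    qed (use z in auto)
    then show ?thesis using nz[OF z] by (simp add: norm_divide pos_divide_le_eq)
  qed
  show ?thesis
  proof (rule tendsto_lowerbound)
    have "((\<lambda>t. (2 / (1 + t)) ^ degree G * cmod (poly G (of_real t * z))) \<longlongrightarrow> (2 / (1 + 1)) ^ degree G * cmod (poly G (of_real 1 * z))) (at_left (1::real))"
      by (intro tendsto_intros) auto
    then show "((\<lambda>t. (2 / (1 + t)) ^ degree G * cmod (poly G (of_real t * z))) \<longlongrightarrow> cmod (poly G z)) (at_left (1::real))"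
      by simp
    show "\<forall>\<^sub>F t in at_left 1. cmod (poly F z) \<le> (2 / (1 + t)) ^ degree G * cmod (poly G (of_real t * z))"
      unfolding eventually_at_left_field by (rule exI[of _ 0]) (use bound in auto)
  qed auto
qed

lemma maximum_modulus_ratio_strict:
  assumes G: "\<And>z. cmod z < 1 \<Longrightarrow> poly G z \<noteq> 0"
    and le: "\<And>z. cmod z = 1 \<Longrightarrow> cmod (poly F z) \<le> cmod (poly G z)"
    and strict: "cmod (poly F 0) < cmod (poly G 0)" and z: "cmod z < 1"
  shows "cmod (poly F z) < cmod (poly G z)"
proof (rule ccontr)
  assume "\<not> ?thesis"
  define h where "h = (\<lambda>z. poly F z / poly G z)"
  have "cmod (h x) \<le> 1" if "cmod x < 1" for x
    using maximum_modulus_ratio[OF G le, of x] G[OF that] that by (simp add: h_def norm_divide)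
  moreover have hz: "cmod (h z) \<ge> 1" using \<open>\<not> _\<close> G[OF z] by (simp add: h_def norm_divide)
  ultimately have "h constant_on ball 0 1"
    using G z unfolding h_def
    by (intro maximum_modulus_principle[of _ _ "ball 0 1" z])
       (auto intro!: holomorphic_intros simp: dist_norm intro: order_trans)
  then have "h z = h 0" using z by (auto simp: constant_on_def)
  moreover have "cmod (h 0) < 1" using strict G[of 0] by (simp add: h_def norm_divide)
  ultimately show False using hz by simp
qed

lemma multiplier_symmetrized:
  "multiplier n (\<lambda>k. g k + w * cnj (g (n - k))) P
    = multiplier n g P + smult w (conj_reciprocal n (multiplier n g (conj_reciprocal n P)))"
  by (rule poly_eqI) (auto simp: coeff_multiplier coeff_conj_reciprocal algebra_simps)

text \<open>
Let \<open>T\<close> be the multiplier \<open>g\<close> and let \<open>P\<^sup>*\<close> be the conjugate reciprocal of \<open>P\<close>. The symmetrized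
multiplier maps \<open>P\<close> to \<open>T[P] + w F\<^sup>*\<close> with \<open>F = T[P\<^sup>*]\<close>, so it is enough that \<open>|F\<^sup>*| < |T[P]|\<close>
outside the disc. On the circle \<open>|F| \<le> |T[P]|\<close>, because \<open>|P\<^sup>*| \<le> |P|\<close> outside the disc. After inversion
in the circle this becomes a comparison of \<open>F\<close> with the zero-free \<open>(T[P])\<^sup>*\<close> in the disc, which is strict at
\<open>0\<close> by \<open>|g 0| < |g n|\<close> and hence, by the maximum modulus principle, everywhere in the open disc.
\<close>

lemma admissible_symmetrized:
  assumes g: "admissible n g" and g0: "cmod (g 0) < cmod (g n)" and w: "cmod w = 1"
  shows "admissible n (\<lambda>k. g k + w * cnj (g (n - k)))"
  unfolding admissible_def
proof (intro allI impI)
  fix P assume P: "disc_zeros n P"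
  define TP where "TP = multiplier n g P"
  define F where "F = multiplier n g (conj_reciprocal n P)"
  define G where "G = conj_reciprocal n TP"
  have TP: "disc_zeros n TP" using g P by (simp add: TP_def admissible_def)
  have dTP: "degree TP \<le> n" "degree F \<le> n" "degree G \<le> n"
    by (auto simp: TP_def F_def G_def degree_multiplier degree_conj_reciprocal)
  have GG: "conj_reciprocal n G = TP" by (simp add: G_def conj_reciprocal_twice dTP)
  have eq: "multiplier n (\<lambda>k. g k + w * cnj (g (n - k))) P = TP + smult w (conj_reciprocal n F)"
    unfolding TP_def F_def by (rule multiplier_symmetrized)
  have F_lt_G: "cmod (poly F z) < cmod (poly G z)" if "cmod z < 1" for z
  proof (rule maximum_modulus_ratio_strict[OF _ _ _ that])
    show "poly G z \<noteq> 0" if z: "cmod z < 1" for z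
    proof (cases "z = 0")
      case True
      then show ?thesis using disc_zeros_coeff[OF TP] by (simp add: G_def poly_0_coeff_0 coeff_conj_reciprocal)
    next
      case False
      then have "cmod (1 / cnj z) > 1" using z by (simp add: norm_divide)
      then show ?thesis using disc_zeros_outside[OF TP] False by (simp add: G_def poly_conj_reciprocal dTP)
    qed
    show "cmod (poly F z) \<le> cmod (poly G z)" if z: "cmod z = 1" for z
      using multiplier_dominated[OF g P degree_conj_reciprocal norm_conj_reciprocal_outside[OF P], of z] z
      by (simp add: F_def G_def norm_conj_reciprocal_circle dTP TP_def[symmetric])
    show "cmod (poly F 0) < cmod (poly G 0)"
      using g0 disc_zeros_coeff[OF P]
      by (simp add: F_def G_def TP_def poly_0_coeff_0 coeff_multiplier coeff_conj_reciprocal norm_mult)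
  qed
  have F_lt: "cmod (poly (conj_reciprocal n F) z) < cmod (poly TP z)" if z: "cmod z > 1" for z
  proof -
    have "cmod (1 / cnj z) < 1" "z \<noteq> 0" using z by (auto simp: norm_divide divide_less_eq)
    then show ?thesis
      using F_lt_G[of "1 / cnj z"]
      by (simp add: GG[symmetric] poly_conj_reciprocal dTP norm_mult)
  qed
  show "disc_zeros n (multiplier n (\<lambda>k. g k + w * cnj (g (n - k))) P)"
  proof (rule disc_zerosI[OF degree_multiplier])
    have "g n + w * cnj (g 0) \<noteq> 0"
    proof
      assume "g n + w * cnj (g 0) = 0"
      then have "cmod (g n) = cmod (g 0)" using w
        by (metis add_eq_0_iff2 norm_minus_cancel norm_mult complex_mod_cnj mult_1)
      then show False using g0 by simp
    qed
    then show "coeff (multiplier n (\<lambda>k. g k + w * cnj (g (n - k))) P) n \<noteq> 0"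
      using disc_zeros_coeff[OF P] by (simp add: coeff_multiplier)
    fix z :: complex assume z: "cmod z > 1"
    show "poly (multiplier n (\<lambda>k. g k + w * cnj (g (n - k))) P) z \<noteq> 0"
    proof
      assume "poly (multiplier n (\<lambda>k. g k + w * cnj (g (n - k))) P) z = 0"
      then have "poly TP z = - (w * poly (conj_reciprocal n F) z)" by (simp add: eq add_eq_0_iff2)
      then have "cmod (poly TP z) = cmod (poly (conj_reciprocal n F) z)"
        using w by (simp add: norm_mult)
      then show False using F_lt[OF z] by simp
    qed
  qed
qed

text \<open>
The factor by which \<open>P \<mapsto> B[P(R z)] - \<alpha> B[P]\<close> multiplies the coefficient of \<open>z^k\<close>.
\<close>

definition dilation_B :: "nat \<Rightarrow> complex \<Rightarrow> complex \<Rightarrow> complex \<Rightarrow> complex \<Rightarrow> real \<Rightarrow> nat \<Rightarrow> complex" where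
  "dilation_B n l0 l1 l2 \<alpha> R k = (of_real R ^ k - \<alpha>) * B_symbol n l0 l1 l2 k"

lemma dilation_B_multiplier:
  assumes "degree P \<le> n"
  shows "B_op n l0 l1 l2 (P \<circ>\<^sub>p [:0, of_real R:]) - smult \<alpha> (B_op n l0 l1 l2 P)
    = multiplier n (dilation_B n l0 l1 l2 \<alpha> R) P"
  using assms
  by (intro poly_eqI)
     (simp add: coeff_multiplier coeff_B_op coeff_pcompose_linear dilation_B_def coeff_eq_0 algebra_simps)

lemma norm_dilate_less:
  fixes z a :: complex
  assumes z: "cmod z \<ge> 1" and a: "cmod a \<le> 1" and R: "R > 1"
  shows "cmod (z - a) < cmod (of_real R * z - a)"
proof (rule power2_less_imp_less)
  define s c where "s = cmod z" and "c = Re (z * cnj a)"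
  have c: "c \<le> s"
  proof -
    have "c \<le> cmod z * cmod a" using abs_Re_le_cmod[of "z * cnj a"] by (simp add: c_def norm_mult)
    also have "\<dots> \<le> s" using a by (simp add: s_def mult_left_le)
    finally show ?thesis .
  qed
  have n1: "(cmod (of_real u * z - a))\<^sup>2 = u\<^sup>2 * s\<^sup>2 - 2 * u * c + (cmod a)\<^sup>2" for u
    unfolding s_def by (simp only: cmod_power2) (simp add: c_def power2_eq_square algebra_simps)
  have "(cmod (of_real R * z - a))\<^sup>2 - (cmod (z - a))\<^sup>2 = (R - 1) * ((R + 1) * s\<^sup>2 - 2 * c)"
    using n1[of R] n1[of 1] by (simp add: power2_eq_square algebra_simps)
  moreover have "(R + 1) * s\<^sup>2 > 2 * c"
  proof -
    have "2 * s\<^sup>2 < (R + 1) * s\<^sup>2" using R z by (intro mult_strict_right_mono) (auto simp: s_def)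
    moreover have "s \<le> s\<^sup>2" using z by (simp add: s_def power2_eq_square mult_le_cancel_left1)
    ultimately show ?thesis using c by linarith
  qed
  ultimately have "(cmod (of_real R * z - a))\<^sup>2 - (cmod (z - a))\<^sup>2 > 0" using R by simp
  then show "(cmod (z - a))\<^sup>2 < (cmod (of_real R * z - a))\<^sup>2" by simp
qed simp

text \<open>
The operator is \<open>B\<close> applied to \<open>P(R z) - \<alpha> P(z)\<close>, and moving \<open>z\<close> outwards increases the distance
to every zero of \<open>P\<close>.
\<close>

lemma admissible_dilation_B:
  assumes n: "n \<ge> 1" and B: "B_class_params n l0 l1 l2" and \<alpha>: "cmod \<alpha> \<le> 1" and R: "R > 1"
  shows "admissible n (dilation_B n l0 l1 l2 \<alpha> R)"
  unfolding admissible_def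
proof (intro allI impI)
  fix P assume P: "disc_zeros n P"
  obtain c r where c: "c \<noteq> 0" and r: "\<And>i. i < n \<Longrightarrow> cmod (r i) \<le> 1"
    and Pz: "\<And>z. poly P z = c * (\<Prod>i<n. z - r i)"
    by (rule disc_zeros_factors[OF P]) blast
  have dP: "degree P \<le> n" using P by (simp add: disc_zeros_def)
  define Q where "Q = P \<circ>\<^sub>p [:0, of_real R:] - smult \<alpha> P"
  have R\<alpha>: "of_real R ^ n - \<alpha> \<noteq> 0"
  proof
    assume "of_real R ^ n - \<alpha> = 0"
    then have "\<alpha> = of_real R ^ n" by simp
    then have "cmod \<alpha> = R ^ n" using R by (simp add: norm_power)
    moreover have "R ^ n > 1" using R n by (simp add: one_less_power)
    ultimately show False using \<alpha> by linarith
  qed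
  have dQ: "degree Q \<le> n" unfolding Q_def
    using dP by (intro degree_diff_le order_trans[OF degree_pcompose_le] order_trans[OF degree_smult_le]) auto
  have Q: "disc_zeros n Q"
  proof (rule disc_zerosI[OF dQ])
    show "coeff Q n \<noteq> 0" using R\<alpha> disc_zeros_coeff[OF P]
      by (simp add: Q_def coeff_pcompose_linear left_diff_distrib[symmetric])
    fix z :: complex assume z: "cmod z > 1"
    have lt: "cmod (z - r i) < cmod (of_real R * z - r i)" if "i < n" for i
      using norm_dilate_less[OF less_imp_le[OF z] r R] that .
    have "(\<Prod>i<n. cmod (z - r i)) < (\<Prod>i<n. cmod (of_real R * z - r i))"
    proof (rule prod_mono_strict[of 0])
      show "cmod (of_real R * z - r i) > 0" if "i \<in> {..<n}" for i
        using lt[of i] that by (intro le_less_trans[OF norm_ge_zero]) auto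
    qed (use n lt in \<open>auto intro: less_imp_le\<close>)
    then have "cmod (poly P z) < cmod (poly P (of_real R * z))"
      using c by (simp add: Pz norm_mult prod_norm[symmetric])
    moreover have "cmod (\<alpha> * poly P z) \<le> cmod (poly P z)"
      using \<alpha> by (simp add: norm_mult mult_left_le_one_le)
    ultimately show "poly Q z \<noteq> 0" by (auto simp: Q_def poly_pcompose mult.commute)
  qed
  have eq: "multiplier n (dilation_B n l0 l1 l2 \<alpha> R) P = B_op n l0 l1 l2 Q"
    by (rule poly_eqI) (use dP in \<open>simp add: coeff_multiplier coeff_B_op Q_def coeff_pcompose_linear dilation_B_def coeff_eq_0 algebra_simps\<close>)
  show "disc_zeros n (multiplier n (dilation_B n l0 l1 l2 \<alpha> R) P)"
  proof (rule disc_zerosI[OF degree_multiplier])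
    show "coeff (multiplier n (dilation_B n l0 l1 l2 \<alpha> R) P) n \<noteq> 0"
      using disc_zeros_coeff[OF Q] Lambda_dominates[OF n B] by (simp add: eq coeff_B_op B_symbol_n)
    show "poly (multiplier n (dilation_B n l0 l1 l2 \<alpha> R) P) z \<noteq> 0" if "cmod z > 1" for z
      unfolding eq by (rule B_op_disc_zeros_outside[OF n B Q that])
  qed
qed

lemma dilation_B_ends:
  assumes n: "n \<ge> 1" and B: "B_class_params n l0 l1 l2" and \<alpha>: "cmod \<alpha> \<le> 1" and R: "R > 1"
  shows "cmod (dilation_B n l0 l1 l2 \<alpha> R 0) < cmod (dilation_B n l0 l1 l2 \<alpha> R n)"
proof -
  have "R ^ n > 1" using R n by (simp add: one_less_power)
  then have "cmod (1 - \<alpha>) < cmod (of_real (R ^ n) * 1 - \<alpha>)"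
    using norm_dilate_less[of 1 \<alpha> "R ^ n"] \<alpha> by simp
  moreover have "cmod l0 \<le> cmod (Lambda n l0 l1 l2)" "Lambda n l0 l1 l2 \<noteq> 0"
    using Lambda_dominates[OF n B] by auto
  ultimately have "cmod (1 - \<alpha>) * cmod l0 \<le> cmod (1 - \<alpha>) * cmod (Lambda n l0 l1 l2)"
    "cmod (1 - \<alpha>) * cmod (Lambda n l0 l1 l2) < cmod (of_real (R ^ n) * 1 - \<alpha>) * cmod (Lambda n l0 l1 l2)"
    by (auto intro: mult_left_mono)
  then show ?thesis by (simp add: dilation_B_def B_symbol_n B_symbol_0 norm_mult)
qed

section \<open>Integrals over the circle and Jensen's formula\<close>

lemma circle_const: "((\<lambda>t. c::real) has_integral 2*pi * c) {0..2*pi}"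
  using has_integral_const_real[of c 0 "2*pi"] by simp

lemma integral_le_except_finite:
  fixes f h :: "real \<Rightarrow> real"
  assumes "f integrable_on S" "h integrable_on S" "finite E" "\<And>t. t \<in> S - E \<Longrightarrow> f t \<le> h t"
  shows "integral S f \<le> integral S h"
proof -
  let ?f = "\<lambda>t. if t \<in> E then h t else f t"
  have f: "(?f has_integral integral S f) S"
    by (rule has_integral_spike_finite[OF assms(3) _ integrable_integral[OF assms(1)]]) auto
  show ?thesis
    by (rule has_integral_le[OF f integrable_integral[OF assms(2)]]) (use assms(4) in auto)
qed

lemma circle_rotation:
  fixes f :: "complex \<Rightarrow> real"
  assumes f: "((\<lambda>t. f (cis t)) has_integral I) {0..2*pi}" and w: "cmod w = 1"
  shows "((\<lambda>t. f (w * cis t)) has_integral I) {0..2*pi}"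
proof -
  define c where "c = Arg2pi w"
  have c: "0 \<le> c" "c \<le> 2*pi" "w = cis c"
    using Arg2pi[of w] w by (auto simp: c_def is_Arg_def cis_conv_exp)
  have int: "(\<lambda>t. f (cis t)) integrable_on {0..2*pi}" using f by (auto simp: integrable_on_def)
  obtain I1 I2 where I1: "((\<lambda>t. f (cis t)) has_integral I1) {0..c}"
    and I2: "((\<lambda>t. f (cis t)) has_integral I2) {c..2*pi}"
    using integrable_subinterval_real[OF int, of 0 c] integrable_subinterval_real[OF int, of c "2*pi"] c
    by (auto simp: integrable_on_def)
  have I: "I = I1 + I2"
    using has_integral_combine[OF c(1,2) I1 I2] f by (rule has_integral_unique[rotated])
  have "((\<lambda>t. f (cis (1 * t - 2*pi))) has_integral I1) {2*pi..2*pi + c}"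
    using has_integral_affinity'[of "\<lambda>t. f (cis t)" I1 0 c 1 "- 2*pi"] I1 by (simp add: add.commute)
  then have "((\<lambda>t. f (cis t)) has_integral I1) {2*pi..2*pi + c}"
    by (simp add: cis_divide[symmetric])
  then have "((\<lambda>t. f (cis t)) has_integral I2 + I1) {c..2*pi + c}"
    using c by (intro has_integral_combine[OF _ _ I2]) auto
  then have "((\<lambda>t. f (cis (1 * t + c))) has_integral I2 + I1) {0..2*pi}"
    using has_integral_affinity'[of "\<lambda>t. f (cis t)" "I2 + I1" c "2*pi+c" 1 c] by simp
  then show ?thesis by (simp add: c(3) cis_mult add.commute I)
qed

lemma circle_power:
  fixes f :: "complex \<Rightarrow> real"
  assumes f: "((\<lambda>t. f (cis t)) has_integral I) {0..2*pi}" and n: "n \<ge> (1::nat)"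
  shows "((\<lambda>t. f (cis t ^ n)) has_integral I) {0..2*pi}"
proof -
  have "((\<lambda>t. f (cis t)) has_integral real m * I) {0..2*pi * real m}" for m
  proof (induction m)
    case (Suc m)
    have "((\<lambda>t. f (cis (1 * t - 2*pi * real m))) has_integral I) {2*pi * real m..2*pi + 2*pi * real m}"
      using has_integral_affinity'[of "\<lambda>t. f (cis t)" I 0 "2*pi" 1 "- (2*pi * real m)"] f by simp
    moreover have "cis (2 * pi * real m) = 1" by (rule cis_multiple_2pi) auto
    ultimately have "((\<lambda>t. f (cis t)) has_integral I) {2*pi * real m..2*pi + 2*pi * real m}"
      by (simp add: cis_divide[symmetric])
    then have "((\<lambda>t. f (cis t)) has_integral real m * I + I) {0..2*pi + 2*pi * real m}"
      by (intro has_integral_combine[OF _ _ Suc.IH]) auto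
    then show ?case by (simp add: algebra_simps)
  next
    case 0
    show ?case using has_integral_refl(1)[of _ "0::real"] by simp
  qed
  from has_integral_affinity'[of "\<lambda>t. f (cis t)" "real n * I" 0 "2*pi * real n" "real n" 0] this[of n] n
  have "((\<lambda>t. f (cis (real n * t))) has_integral I) {0..2*pi}"
    by (simp add: field_simps)
  then show ?thesis unfolding Complex.DeMoivre .
qed

lemma circle_conj:
  fixes f :: "complex \<Rightarrow> real"
  assumes f: "((\<lambda>t. f (cis t)) has_integral I) {0..2*pi}"
  shows "((\<lambda>t. f (cnj (cis t))) has_integral I) {0..2*pi}"
proof -
  have "((\<lambda>t. f (cis (- t))) has_integral I) {- (2*pi)..- 0}"
    by (subst has_integral_reflect_real) (use f in auto)
  then have "((\<lambda>t. f (cis (- t))) has_integral I) {- (2*pi)..0}" by simp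
  then have "((\<lambda>t. f (cis (- (1 * t - 2 * pi)))) has_integral I) {0..2*pi}"
    using has_integral_affinity'[of "\<lambda>t. f (cis (- t))" I "- (2*pi)" 0 1 "- (2*pi)"] by simp
  then show ?thesis by (simp add: cis_divide[symmetric] cis_cnj divide_inverse)
qed

lemma circle_linear_swap:
  fixes f :: "real \<Rightarrow> real"
  assumes f: "((\<lambda>t. f (cmod (a + b * cis t))) has_integral I) {0..2*pi}"
  shows "((\<lambda>t. f (cmod (b + a * cis t))) has_integral I) {0..2*pi}"
proof -
  have eq: "cmod (a + b * cnj (cis t)) = cmod (b + a * cis t)" for t
  proof -
    have "b + a * cis t = cis t * (a + b * cnj (cis t))" by (simp add: algebra_simps cis_cnj cis_mult)
    then show ?thesis by (simp add: norm_mult)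
  qed
  show ?thesis using circle_conj[OF f] unfolding eq .
qed

text \<open>
Up to a rotation of the circle and a unimodular factor, \<open>a + b z\<close> depends only on \<open>|a|\<close> and \<open>|b|\<close>.
\<close>

lemma circle_linear_cong:
  fixes f :: "real \<Rightarrow> real"
  assumes f: "((\<lambda>t. f (cmod (a + b * cis t))) has_integral I) {0..2*pi}"
    and ab: "cmod a' = cmod a" "cmod b' = cmod b"
  shows "((\<lambda>t. f (cmod (a' + b' * cis t))) has_integral I) {0..2*pi}"
proof -
  have "\<exists>w. cmod w = 1 \<and> (\<forall>z. cmod (a' + b' * z) = cmod (a + b * (w * z)))"
  proof (cases "a = 0 \<or> b = 0")
    case True
    then show ?thesis using ab by (intro exI[of _ 1]) (auto simp: norm_mult)
  next
    case False
    have nz: "a' \<noteq> 0" "b' \<noteq> 0" using False ab by auto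
    define u where "u = a / a'"
    have u: "cmod u = 1" using False ab by (simp add: u_def norm_divide)
    have "a + b * ((b' * u / b) * z) = u * (a' + b' * z)" for z
      using False nz by (simp add: u_def field_simps)
    then have "cmod (a' + b' * z) = cmod (a + b * ((b' * u / b) * z))" for z
      by (simp add: norm_mult u)
    moreover have "cmod (b' * u / b) = 1" using u ab False by (simp add: norm_mult norm_divide)
    ultimately show ?thesis by blast
  qed
  then obtain w where w: "cmod w = 1" "\<And>z. cmod (a' + b' * z) = cmod (a + b * (w * z))" by blast
  show ?thesis
    unfolding w(2) using circle_rotation[of "\<lambda>z. f (cmod (a + b * z))", OF f w(1)] .
qed

lemma finite_cis_eq: "finite {t\<in>{0..2*pi}. cis t = a}"
proof -
  have inj: "inj_on cis {0..<2*pi}"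
  proof (rule inj_onI)
    fix x y assume "x \<in> {0..<2*pi}" "y \<in> {0..<2*pi}" "cis x = cis y"
    then show "x = y"
      using Arg2pi_unique[of 1 x "cis x"] Arg2pi_unique[of 1 y "cis y"] by (simp add: cis_conv_exp)
  qed
  have "finite (cis -` {a} \<inter> {0..<2*pi})" by (rule finite_vimage_IntI[OF _ inj]) simp
  moreover have "{t\<in>{0..2*pi}. cis t = a} \<subseteq> insert (2*pi) (cis -` {a} \<inter> {0..<2*pi})" by auto
  ultimately show ?thesis by (meson finite_insert finite_subset)
qed

lemma finite_poly_cis_zeros:
  assumes "Q \<noteq> 0" shows "finite {t\<in>{0..2*pi}. poly Q (cis t) = 0}"
proof -
  have "{t\<in>{0..2*pi}. poly Q (cis t) = 0} = (\<Union>a\<in>{z. poly Q z = 0}. {t\<in>{0..2*pi}. cis t = a})"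
    by auto
  then show ?thesis using poly_roots_finite[OF assms] finite_cis_eq by simp
qed

text \<open>
The mean value property of the harmonic function \<open>Re (Ln (1 + r z))\<close>.
\<close>

lemma log_integral_inside:
  assumes r: "0 \<le> r" "r < 1"
  shows "((\<lambda>t. ln (cmod (1 + of_real r * cis t))) has_integral 0) {0..2*pi}"
proof -
  have Re: "Re (1 + of_real r * z) > 0" if "cmod z \<le> 1" for z
  proof -
    have "\<bar>r * Re z\<bar> \<le> r * 1"
      unfolding abs_mult using r that abs_Re_le_cmod[of z] by (intro mult_mono) auto
    then show ?thesis using r by simp
  qed
  define f where "f = (\<lambda>z. Ln (1 + of_real r * z))"
  have "f holomorphic_on cball 0 1"
    unfolding f_def using Re by (intro holomorphic_intros) (fastforce simp: complex_nonpos_Reals_iff)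
  then have "((\<lambda>u. f u / (u - 0)) has_contour_integral (2 * of_real pi * \<i> * f 0)) (circlepath 0 1)"
    by (rule Cauchy_integral_circlepath_simple) simp
  then have "((\<lambda>t. \<i> * f (cis t)) has_integral 0) {0..2*pi}"
    by (simp add: circlepath_def has_contour_integral_part_circlepath_iff f_def mult_ac)
  from has_integral_linear[OF this bounded_linear_Im]
  have "((\<lambda>t. Re (f (cis t))) has_integral 0) {0..2*pi}" by (simp add: o_def)
  moreover have "Re (f (cis t)) = ln (cmod (1 + of_real r * cis t))" for t
  proof -
    have "1 + of_real r * cis t \<noteq> 0"
      using Re[of "cis t"] by (metis less_irrefl norm_cis order_refl zero_complex.simps(1))
    then show ?thesis unfolding f_def by (simp add: Re_Ln)
  qed
  ultimately show ?thesis by simp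
qed

text \<open>
That is, \<open>|1 + r e^(it)| / (1 + r)\<close> decreases in \<open>r\<close>. The normalisation by \<open>1 + r\<close> is what makes
monotone convergence applicable as \<open>r \<rightarrow> 1\<close>.
\<close>

lemma norm_one_plus_scaled_mono:
  assumes r: "0 \<le> r" "r \<le> r'" "r' \<le> 1"
  shows "(1 + r) * cmod (1 + of_real r' * cis t) \<le> (1 + r') * cmod (1 + of_real r * cis t)"
proof (rule power2_le_imp_le)
  have sq: "(cmod (1 + of_real u * cis t))\<^sup>2 = 1 + 2 * u * cos t + u\<^sup>2" for u
  proof -
    have "(1 + u * cos t)\<^sup>2 + (u * sin t)\<^sup>2 = 1 + 2 * u * cos t + u\<^sup>2"
      using sin_cos_squared_add[of t] by algebra
    then show ?thesis by (simp only: cmod_power2, simp)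
  qed
  have "(1 + r')\<^sup>2 * (1 + 2 * r * cos t + r\<^sup>2) - (1 + r)\<^sup>2 * (1 + 2 * r' * cos t + r'\<^sup>2)
     = 2 * (1 - cos t) * ((r' - r) * (1 - r * r'))"
    by (simp add: power2_eq_square algebra_simps)
  also have "\<dots> \<ge> 0"
    using r by (intro mult_nonneg_nonneg) (auto simp: mult_le_one)
  finally show "((1 + r) * cmod (1 + of_real r' * cis t))\<^sup>2 \<le> ((1 + r') * cmod (1 + of_real r * cis t))\<^sup>2"
    unfolding power_mult_distrib sq by simp
qed (use assms in auto)

text \<open>
Here the integrand has a logarithmic singularity at \<open>t = \<pi>\<close>. The functions
\<open>ln (1 + r) - ln |1 + r e^(it)|\<close> increase with \<open>r\<close> and have known integrals, so the limit \<open>r \<rightarrow> 1\<close>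
may be taken under the integral sign.
\<close>

lemma log_integral_boundary:
  "((\<lambda>t. ln (cmod (1 + cis t))) has_integral 0) {0..2*pi}"
proof -
  define r where "r k = 1 - inverse (real (Suc k))" for k
  have r: "0 \<le> r k" "r k < 1" "r k \<le> r (Suc k)" for k
    by (auto simp: r_def inverse_eq_divide field_simps)
  have rlim: "r \<longlonglongrightarrow> 1" unfolding r_def using LIMSEQ_inverse_real_of_nat_add_minus[of 1] by simp
  define E where "E = {t\<in>{0..2*pi}. cis t = - 1}"
  define S where "S = {0..2*pi} - E"
  have E: "finite E" unfolding E_def by (rule finite_cis_eq)
  have S_iff: "(f has_integral y) S \<longleftrightarrow> (f has_integral y) {0..2*pi}" for f :: "real \<Rightarrow> real" and y
    by (rule has_integral_spike_set_eq)
       (use E in \<open>auto simp: S_def intro!: negligible_subset[OF negligible_finite[OF E]]\<close>)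
  define h where "h k t = ln (1 + r k) - ln (cmod (1 + of_real (r k) * cis t))" for k t
  define g where "g t = ln 2 - ln (cmod (1 + cis t))" for t
  have pos: "cmod (1 + of_real (r k) * cis t) > 0" for k t
  proof -
    have "cmod (1 + of_real (r k) * cis t) \<ge> cmod 1 - cmod (of_real (r k) * cis t)"
      by (metis add.commute norm_diff_ineq)
    also have "cmod (of_real (r k) * cis t) = r k" using r[of k] by (simp add: norm_mult)
    finally show ?thesis using r[of k] unfolding norm_one by linarith
  qed
  have "(g has_integral 2*pi * ln 2) S"
  proof (rule has_integral_monotone_convergence_increasing)
    have "((\<lambda>t. ln (1 + r k) - ln (cmod (1 + of_real (r k) * cis t))) has_integral 2*pi * ln (1 + r k) - 0) {0..2*pi}" for k
      by (intro has_integral_diff log_integral_inside r circle_const)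
    then show "(h k has_integral 2*pi * ln (1 + r k)) S" for k
      unfolding S_iff h_def by simp
    show "h k t \<le> h (Suc k) t" for k t
    proof -
      have "ln ((1 + r k) * cmod (1 + of_real (r (Suc k)) * cis t)) \<le> ln ((1 + r (Suc k)) * cmod (1 + of_real (r k) * cis t))"
        using norm_one_plus_scaled_mono[of "r k" "r (Suc k)" t] r[of k] r[of "Suc k"] pos by (subst ln_le_cancel_iff) (auto intro!: mult_pos_pos)
      then show ?thesis
        using r[of k] r[of "Suc k"] pos by (simp add: h_def ln_mult_pos)
    qed
    show "(\<lambda>k. h k t) \<longlonglongrightarrow> g t" if "t \<in> S" for t
    proof -
      have "1 + cis t \<noteq> 0" using that by (auto simp: S_def E_def add_eq_0_iff)
      moreover have "(\<lambda>k. cmod (1 + of_real (r k) * cis t)) \<longlonglongrightarrow> cmod (1 + of_real 1 * cis t)"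
        by (intro tendsto_intros rlim)
      moreover have "(\<lambda>k. 1 + r k) \<longlonglongrightarrow> 1 + 1" by (intro tendsto_intros rlim)
      ultimately show ?thesis unfolding h_def g_def
        by (intro tendsto_diff tendsto_ln) auto
    qed
    have "(\<lambda>k. 2 * pi * ln (1 + r k)) \<longlonglongrightarrow> 2 * pi * ln (1 + 1)" by (intro tendsto_intros rlim) auto
    then show "(\<lambda>k. 2 * pi * ln (1 + r k)) \<longlonglongrightarrow> 2 * pi * ln 2" by simp
  qed
  then have "(g has_integral 2*pi * ln 2) {0..2*pi}" unfolding S_iff .
  then have "((\<lambda>t. ln 2 - g t) has_integral 2*pi * ln 2 - 2*pi * ln 2) {0..2*pi}"
    by (intro has_integral_diff circle_const)
  then show ?thesis by (simp add: g_def)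
qed

text \<open>
Jensen's formula for a linear polynomial, including a zero on the circle. By the symmetry in
\<open>|a|\<close> and \<open>|b|\<close> the constant term may be assumed to dominate.
\<close>

lemma Jensen_linear:
  assumes ab: "a \<noteq> 0 \<or> b \<noteq> 0"
  shows "((\<lambda>t. ln (cmod (a + b * cis t))) has_integral 2*pi * ln (max (cmod a) (cmod b))) {0..2*pi}"
proof -
  have main: "((\<lambda>t. ln (cmod (a + b * cis t))) has_integral 2*pi * ln (cmod a)) {0..2*pi}"
    if le: "cmod b \<le> cmod a" and a: "a \<noteq> 0" for a b
  proof -
    define r where "r = cmod b / cmod a"
    have r: "0 \<le> r" "r \<le> 1" using le a by (auto simp: r_def)
    have base: "((\<lambda>t. ln (cmod (1 + of_real r * cis t))) has_integral 0) {0..2*pi}"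
      using log_integral_inside[of r] log_integral_boundary r by (cases "r = 1") auto
    have "((\<lambda>t. ln (cmod a) + ln (cmod (1 + of_real r * cis t))) has_integral 2*pi * ln (cmod a) + 0) {0..2*pi}"
      by (intro has_integral_add base circle_const)
    then have sum: "((\<lambda>t. ln (cmod a) + ln (cmod (1 + of_real r * cis t))) has_integral 2*pi * ln (cmod a)) {0..2*pi}"
      by simp
    have "((\<lambda>t. ln (cmod (of_real (cmod a) + of_real (cmod b) * cis t))) has_integral 2*pi * ln (cmod a)) {0..2*pi}"
    proof (rule has_integral_spike_finite[OF _ _ sum])
      show "finite {t\<in>{0..2*pi}. poly [:1, of_real r:] (cis t) = 0}"
        by (rule finite_poly_cis_zeros) simp
      fix t assume "t \<in> {0..2*pi} - {t\<in>{0..2*pi}. poly [:1, of_real r:] (cis t) = 0}"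
      then have "1 + of_real r * cis t \<noteq> 0" by (simp add: mult.commute)
      moreover have "of_real (cmod a) + of_real (cmod b) * cis t = of_real (cmod a) * (1 + of_real r * cis t)"
        using a by (simp add: r_def field_simps)
      ultimately show "ln (cmod (of_real (cmod a) + of_real (cmod b) * cis t))
          = ln (cmod a) + ln (cmod (1 + of_real r * cis t))"
        using a by (simp add: norm_mult ln_mult_pos)
    qed
    then show ?thesis by (rule circle_linear_cong) auto
  qed
  show ?thesis
  proof (cases "cmod b \<le> cmod a")
    case True
    moreover have "a \<noteq> 0" using ab True by auto
    ultimately show ?thesis using main[of b a] by (simp add: max_absorb1)
  next
    case False
    then have "max (cmod a) (cmod b) = cmod b" "b \<noteq> 0" by auto
    with circle_linear_swap[OF main[of a b]] False show ?thesis by simp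
  qed
qed

lemma log_integral_product:
  fixes r :: "nat \<Rightarrow> complex"
  assumes c: "c \<noteq> 0"
  shows "((\<lambda>t. ln (cmod (c * (\<Prod>i<m. cis t - r i)))) has_integral
    2*pi * (ln (cmod c) + (\<Sum>i<m. ln (max 1 (cmod (r i)))))) {0..2*pi}"
proof (induction m)
  case 0
  show ?case using circle_const[of "ln (cmod c)"] by simp
next
  case (Suc m)
  have "((\<lambda>t. ln (cmod (- r m + 1 * cis t))) has_integral 2*pi * ln (max (cmod (- r m)) (cmod 1))) {0..2*pi}"
    by (rule Jensen_linear) simp
  from has_integral_add[OF Suc this]
  have sum: "((\<lambda>t. ln (cmod (c * (\<Prod>i<m. cis t - r i))) + ln (cmod (cis t - r m))) has_integral
    2*pi * (ln (cmod c) + (\<Sum>i<Suc m. ln (max 1 (cmod (r i)))))) {0..2*pi}"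
    by (simp add: algebra_simps max.commute)
  show ?case
  proof (rule has_integral_spike_finite[OF _ _ sum])
    show "finite (\<Union>i\<le>m. {t\<in>{0..2*pi}. cis t = r i})" using finite_cis_eq by simp
    fix t assume "t \<in> {0..2*pi} - (\<Union>i\<le>m. {t\<in>{0..2*pi}. cis t = r i})"
    then have "\<And>i. i \<le> m \<Longrightarrow> cis t \<noteq> r i" by auto
    then have "c * (\<Prod>i<m. cis t - r i) \<noteq> 0" "cis t - r m \<noteq> 0"
      using c by (auto simp: prod_zero_iff)
    then have "ln (cmod (c * (\<Prod>i<m. cis t - r i)) * cmod (cis t - r m))
        = ln (cmod (c * (\<Prod>i<m. cis t - r i))) + ln (cmod (cis t - r m))"
      by (intro ln_mult_pos) auto
    then show "ln (cmod (c * (\<Prod>i<Suc m. cis t - r i)))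
        = ln (cmod (c * (\<Prod>i<m. cis t - r i))) + ln (cmod (cis t - r m))"
      by (simp add: norm_mult mult.assoc)
  qed
qed

lemma log_integrable_poly:
  assumes "Q \<noteq> 0"
  shows "(\<lambda>t. ln (cmod (poly Q (cis t)))) integrable_on {0..2*pi}"
proof -
  obtain r where r: "\<And>z. poly Q z = lead_coeff Q * (\<Prod>i<degree Q. z - r i)"
    by (rule poly_linear_factors[of Q]) blast
  show ?thesis unfolding r integrable_on_def
    using log_integral_product[of "lead_coeff Q" r "degree Q"] assms by auto
qed

lemma log_integral_disc_zeros:
  assumes "disc_zeros n Q"
  shows "((\<lambda>t. ln (cmod (poly Q (cis t)))) has_integral 2*pi * ln (cmod (coeff Q n))) {0..2*pi}"
proof -
  obtain c r where c: "c \<noteq> 0" "c = coeff Q n" and r: "\<And>i. i < n \<Longrightarrow> cmod (r i) \<le> 1"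
    and Qz: "\<And>z. poly Q z = c * (\<Prod>i<n. z - r i)"
    by (rule disc_zeros_factors[OF assms]) blast
  have "(\<Sum>i<n. ln (max 1 (cmod (r i)))) = 0" using r by (intro sum.neutral) (simp add: max_absorb1)
  then show ?thesis using log_integral_product[OF c(1), of r n] by (simp add: Qz c(2)[symmetric])
qed

section \<open>Logarithmic means under an admissible multiplier\<close>

lemma disc_zeros_mult: "disc_zeros m P \<Longrightarrow> disc_zeros k Q \<Longrightarrow> disc_zeros (m + k) (P * Q)"
  using disc_zeros_nonzero by (auto simp: disc_zeros_def degree_mult_eq)

text \<open>
Replace each factor \<open>z - r\<close> with \<open>|r| > 1\<close> by \<open>1 - cnj r z\<close>, and fill up the degree with a power of \<open>z\<close>,
that is, reflect the missing zeros at infinity to \<open>0\<close>.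
\<close>

lemma reflect_zeros_into_disc:
  assumes Q: "Q \<noteq> 0" "degree Q \<le> n"
  obtains G where "disc_zeros n G"
    "\<And>z. cmod z = 1 \<Longrightarrow> cmod (poly G z) = cmod (poly Q z)"
    "\<And>z. cmod z > 1 \<Longrightarrow> cmod (poly Q z) \<le> cmod (poly G z)"
proof -
  obtain r where r: "\<And>z. poly Q z = lead_coeff Q * (\<Prod>i<degree Q. z - r i)"
    by (rule poly_linear_factors[of Q]) blast
  have "\<exists>G. disc_zeros m G \<and> (\<forall>z. cmod z = 1 \<longrightarrow> cmod (poly G z) = cmod (\<Prod>i<m. z - r i))
     \<and> (\<forall>z. cmod z > 1 \<longrightarrow> cmod (\<Prod>i<m. z - r i) \<le> cmod (poly G z))" for m
  proof (induction m)
    case 0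
    show ?case by (intro exI[of _ 1]) (auto simp: disc_zeros_def)
  next
    case (Suc m)
    then obtain G where G: "disc_zeros m G" "\<And>z. cmod z = 1 \<Longrightarrow> cmod (poly G z) = cmod (\<Prod>i<m. z - r i)"
      "\<And>z. cmod z > 1 \<Longrightarrow> cmod (\<Prod>i<m. z - r i) \<le> cmod (poly G z)" by blast
    have "\<exists>L. disc_zeros 1 L \<and> (\<forall>z. cmod z = 1 \<longrightarrow> cmod (poly L z) = cmod (z - r m))
     \<and> (\<forall>z. cmod z > 1 \<longrightarrow> cmod (z - r m) \<le> cmod (poly L z))"
    proof (cases "cmod (r m) \<le> 1")
      case True
      then show ?thesis by (intro exI[of _ "[:- r m, 1:]"]) (auto simp: disc_zeros_def)
    next
      case False
      define L where "L = [:1, - cnj (r m):]"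
      have L: "cmod (poly L z) = cmod (1 - r m * cnj z)" for z
        using complex_mod_cnj[of "1 - r m * cnj z"] by (simp add: L_def mult.commute)
      have "disc_zeros 1 L"
        unfolding disc_zeros_def
      proof (intro conjI allI impI)
        show "degree L = 1" using False by (auto simp: L_def)
        fix z assume "poly L z = 0"
        then have "1 = cmod z * cmod (r m)" unfolding L_def
          by (metis (no_types) L L_def norm_eq_zero complex_mod_cnj eq_iff_diff_eq_0 mult.commute norm_mult norm_one)
        then show "cmod z \<le> 1" using False
          by (metis dual_order.trans linorder_le_cases mult_left_mono mult_1_right norm_ge_zero)
      qed
      moreover have "cmod (1 - r m * cnj z) = cmod (z - r m)" if "cmod z = 1" for z
        using norm_diff_sq_identity[of z "r m"] that by simp
      moreover have "cmod (z - r m) \<le> cmod (1 - r m * cnj z)" if "cmod z > 1" for z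
        using norm_reflect_le_iff[OF that, of "r m"] False by auto
      ultimately show ?thesis unfolding L[symmetric] by blast
    qed
    then obtain L where L: "disc_zeros 1 L" "\<And>z. cmod z = 1 \<Longrightarrow> cmod (poly L z) = cmod (z - r m)"
      "\<And>z. cmod z > 1 \<Longrightarrow> cmod (z - r m) \<le> cmod (poly L z)" by blast
    show ?case
    proof (intro exI[of _ "G * L"] conjI allI impI)
      show "disc_zeros (Suc m) (G * L)" using disc_zeros_mult[OF G(1) L(1)] by simp
    qed (use G L in \<open>auto simp: norm_mult intro!: mult_mono\<close>)
  qed
  then obtain G where G: "disc_zeros (degree Q) G"
    "\<And>z. cmod z = 1 \<Longrightarrow> cmod (poly G z) = cmod (\<Prod>i<degree Q. z - r i)"
    "\<And>z. cmod z > 1 \<Longrightarrow> cmod (\<Prod>i<degree Q. z - r i) \<le> cmod (poly G z)" by blast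
  define k where "k = n - degree Q"
  have "disc_zeros k (monom (lead_coeff Q) k)"
    using Q by (auto simp: disc_zeros_def degree_monom_eq poly_monom)
  from disc_zeros_mult[OF this G(1)] have 1: "disc_zeros n (monom (lead_coeff Q) k * G)"
    using Q by (simp add: k_def)
  show thesis
  proof (rule that[OF 1])
    fix z :: complex
    show "cmod (poly (monom (lead_coeff Q) k * G) z) = cmod (poly Q z)" if "cmod z = 1"
      using G(2)[OF that] that by (simp add: r poly_monom norm_mult norm_power)
    assume z: "cmod z > 1"
    have "cmod (poly Q z) \<le> cmod (lead_coeff Q) * cmod (poly G z)"
      unfolding r norm_mult using G(3)[OF z] by (intro mult_left_mono) auto
    also have "\<dots> \<le> cmod z ^ k * (cmod (lead_coeff Q) * cmod (poly G z))"
      using mult_right_mono[OF one_le_power[of "cmod z" k], of "cmod (lead_coeff Q) * cmod (poly G z)"] z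
      by simp
    finally show "cmod (poly Q z) \<le> cmod (poly (monom (lead_coeff Q) k * G) z)"
      by (simp add: poly_monom norm_mult norm_power mult_ac)
  qed
qed

lemma admissible_coeff: "admissible n g \<Longrightarrow> g n \<noteq> 0"
proof -
  assume g: "admissible n g"
  have "disc_zeros n (monom 1 n)" by (auto simp: disc_zeros_def degree_monom_eq poly_monom)
  with g have "disc_zeros n (multiplier n g (monom 1 n))" by (simp add: admissible_def)
  from disc_zeros_coeff[OF this] show ?thesis by (simp add: multiplier_monom)
qed

text \<open>
With \<open>G\<close> obtained from \<open>Q\<close> by reflecting the zeros into the disc, the logarithmic mean of \<open>Q\<close> is
that of \<open>G\<close>, and the image of \<open>Q\<close> is dominated on the circle by the image of \<open>G\<close>. Both \<open>G\<close>
and its image have all zeros in the disc, so their means are the logarithms of the moduli of their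
leading coefficients.
If the image were zero, its logarithmic mean would be \<open>-\<infinity>\<close>, but \<open>ln 0 = 0\<close> would make the left side
\<open>0\<close>; hence the last hypothesis.
\<close>

lemma Mahler_multiplier:
  assumes g: "admissible n g" and Q: "degree Q \<le> n" and nz: "multiplier n g Q \<noteq> 0"
  shows "integral {0..2*pi} (\<lambda>t. ln (cmod (poly (multiplier n g Q) (cis t))))
    \<le> integral {0..2*pi} (\<lambda>t. ln (cmod (g n * poly Q (cis t))))"
proof -
  have Q0: "Q \<noteq> 0" using nz by (auto simp: multiplier_def)
  obtain G where G: "disc_zeros n G" "\<And>z. cmod z = 1 \<Longrightarrow> cmod (poly G z) = cmod (poly Q z)"
    "\<And>z. cmod z > 1 \<Longrightarrow> cmod (poly Q z) \<le> cmod (poly G z)"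
    by (rule reflect_zeros_into_disc[OF Q0 Q]) blast
  have gn: "g n \<noteq> 0" by (rule admissible_coeff[OF g])
  have gG: "disc_zeros n (multiplier n g G)" using g G by (simp add: admissible_def)
  have "integral {0..2*pi} (\<lambda>t. ln (cmod (poly (multiplier n g Q) (cis t))))
    \<le> integral {0..2*pi} (\<lambda>t. ln (cmod (poly (multiplier n g G) (cis t))))"
  proof (rule integral_le_except_finite)
    show "finite {t\<in>{0..2*pi}. poly (multiplier n g Q) (cis t) = 0}" by (rule finite_poly_cis_zeros[OF nz])
    show "(\<lambda>t. ln (cmod (poly (multiplier n g Q) (cis t)))) integrable_on {0..2*pi}"
      "(\<lambda>t. ln (cmod (poly (multiplier n g G) (cis t)))) integrable_on {0..2*pi}"
      using nz disc_zeros_nonzero[OF gG] by (intro log_integrable_poly; simp)+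
    fix t assume "t \<in> {0..2*pi} - {t\<in>{0..2*pi}. poly (multiplier n g Q) (cis t) = 0}"
    moreover have "cmod (poly (multiplier n g Q) (cis t)) \<le> cmod (poly (multiplier n g G) (cis t))"
      by (rule multiplier_dominated[OF g G(1) Q G(3)]) auto
    ultimately show "ln (cmod (poly (multiplier n g Q) (cis t))) \<le> ln (cmod (poly (multiplier n g G) (cis t)))"
      by (intro ln_mono) auto
  qed
  also have "\<dots> = 2*pi * ln (cmod (g n * coeff G n))"
    using log_integral_disc_zeros[OF gG] by (simp add: integral_unique coeff_multiplier)
  also have "\<dots> = integral {0..2*pi} (\<lambda>t. ln (cmod (poly (smult (g n) G) (cis t))))"
    using log_integral_disc_zeros[of n "smult (g n) G"] G(1) gn
    by (simp add: integral_unique disc_zeros_def)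
  also have "\<dots> = integral {0..2*pi} (\<lambda>t. ln (cmod (g n * poly Q (cis t))))"
    by (simp add: norm_mult G(2))
  finally show ?thesis .
qed

section \<open>From logarithmic means to power means\<close>

lemma nn_integral_interval:
  fixes f :: "real \<Rightarrow> real"
  assumes "(f has_integral I) S" "\<And>t. t \<in> S \<Longrightarrow> 0 \<le> f t"
  shows "(\<integral>\<^sup>+t. ennreal (indicator S t * f t) \<partial>lborel) = ennreal I"
  by (rule nn_integral_has_integral_lebesgue[OF assms(2,1)])

lemma AE_not_in_finite: "finite N \<Longrightarrow> AE t in lborel. (t::real) \<notin> N"
  by (intro AE_not_in finite_imp_null_set_lborel)

lemma ln_norm_le: "cmod w \<le> C \<Longrightarrow> 1 \<le> C \<Longrightarrow> ln (cmod w) \<le> ln C"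
  by (cases "w = 0") (auto intro: ln_mono)

text \<open>
Averaging \<open>ln |f + e^(ib) g|\<close> over \<open>b\<close> turns it into \<open>ln (max |f| |g|)\<close>, by Jensen's formula. The
upper bound \<open>C\<close> makes the integrand nonnegative, so that the order of integration
may be exchanged in spite of the logarithmic singularities.
\<close>

lemma nn_log_average:
  fixes f g :: "real \<Rightarrow> complex"
  assumes cont: "continuous_on UNIV f" "continuous_on UNIV g"
    and C: "C \<ge> 1" "\<And>t. t \<in> {0..2*pi} \<Longrightarrow> cmod (f t) + cmod (g t) \<le> C"
    and fin: "finite {t\<in>{0..2*pi}. f t = 0 \<and> g t = 0}"
    and max: "(\<lambda>t. ln (max (cmod (f t)) (cmod (g t)))) integrable_on {0..2*pi}"
  shows "(\<integral>\<^sup>+b. (\<integral>\<^sup>+t. ennreal (indicator {0..2*pi} b * (indicator {0..2*pi} t * (ln C - ln (cmod (f t + cis b * g t))))) \<partial>lborel) \<partial>lborel)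
    = ennreal (2*pi * (2*pi * ln C - integral {0..2*pi} (\<lambda>t. ln (max (cmod (f t)) (cmod (g t))))))"
proof -
  let ?D = "{0..2*pi}"
  have [measurable]: "f \<in> borel_measurable borel" "g \<in> borel_measurable borel" "cis \<in> borel_measurable borel"
    using cont by (auto intro!: borel_measurable_continuous_onI continuous_on_cis continuous_on_id)
  let ?m = "\<lambda>t. max (cmod (f t)) (cmod (g t))"
  have "(\<integral>\<^sup>+b. (\<integral>\<^sup>+t. ennreal (indicator ?D b * (indicator ?D t * (ln C - ln (cmod (f t + cis b * g t))))) \<partial>lborel) \<partial>lborel)
    = (\<integral>\<^sup>+t. (\<integral>\<^sup>+b. ennreal (indicator ?D b * (indicator ?D t * (ln C - ln (cmod (f t + cis b * g t))))) \<partial>lborel) \<partial>lborel)"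
    by (rule lborel_pair.Fubini') measurable
  also have "\<dots> = (\<integral>\<^sup>+t. ennreal (indicator ?D t * (2*pi * ln C - 2*pi * ln (?m t))) \<partial>lborel)"
  proof (rule nn_integral_cong_AE)
    show "AE t in lborel. (\<integral>\<^sup>+b. ennreal (indicator ?D b * (indicator ?D t * (ln C - ln (cmod (f t + cis b * g t))))) \<partial>lborel)
       = ennreal (indicator ?D t * (2*pi * ln C - 2*pi * ln (?m t)))"
      using AE_not_in_finite[OF fin]
    proof eventually_elim
      fix t assume t: "t \<notin> {t\<in>?D. f t = 0 \<and> g t = 0}"
      show "(\<integral>\<^sup>+b. ennreal (indicator ?D b * (indicator ?D t * (ln C - ln (cmod (f t + cis b * g t))))) \<partial>lborel)
         = ennreal (indicator ?D t * (2*pi * ln C - 2*pi * ln (?m t)))"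
      proof (cases "t \<in> ?D")
        case True
        then have "f t \<noteq> 0 \<or> g t \<noteq> 0" using t by auto
        from has_integral_diff[OF circle_const Jensen_linear[OF this], of "ln C"]
        have I: "((\<lambda>b. ln C - ln (cmod (f t + cis b * g t))) has_integral (2*pi * ln C - 2*pi * ln (?m t))) ?D"
          by (simp add: mult.commute)
        have "cmod (f t + cis b * g t) \<le> C" for b
          using norm_triangle_ineq[of "f t" "cis b * g t"] C(2)[OF True] by (simp add: norm_mult)
        with nn_integral_interval[OF I] ln_norm_le[OF _ C(1)] True show ?thesis by simp
      qed simp
    qed
  qed
  also have "\<dots> = ennreal (2*pi * (2*pi * ln C) - 2*pi * integral ?D (\<lambda>t. ln (?m t)))"
  proof (rule nn_integral_interval)
    show "((\<lambda>t. 2*pi * ln C - 2*pi * ln (?m t)) has_integral 2*pi * (2*pi * ln C) - 2*pi * integral ?D (\<lambda>t. ln (?m t))) ?D"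
      by (intro has_integral_diff circle_const has_integral_mult_right integrable_integral max)
    fix t assume "t \<in> ?D"
    then have "cmod (f t) \<le> C" "cmod (g t) \<le> C"
      using C(2)[of t] norm_ge_zero[of "f t"] norm_ge_zero[of "g t"] by linarith+
    then have "ln (?m t) \<le> ln C" using ln_norm_le C(1) by (auto simp: max_def)
    then show "0 \<le> 2*pi * ln C - 2*pi * ln (?m t)" by simp
  qed
  finally show ?thesis by (simp add: algebra_simps)
qed

text \<open>
An inequality between logarithmic means that holds for almost all \<open>b\<close> passes to the means of the
maxima. The finite set \<open>N\<close> leaves room for parameters at which \<open>f + e^(ib) g\<close> vanishes
identically.
\<close>

lemma log_average_mono:
  fixes f g f' g' :: "real \<Rightarrow> complex"
  assumes cont: "continuous_on UNIV f" "continuous_on UNIV g" "continuous_on UNIV f'" "continuous_on UNIV g'"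
    and fin: "finite {t\<in>{0..2*pi}. f t = 0 \<and> g t = 0}" "finite {t\<in>{0..2*pi}. f' t = 0 \<and> g' t = 0}"
    and max: "(\<lambda>t. ln (max (cmod (f t)) (cmod (g t)))) integrable_on {0..2*pi}"
      "(\<lambda>t. ln (max (cmod (f' t)) (cmod (g' t)))) integrable_on {0..2*pi}"
    and N: "finite N"
    and le: "\<And>b. b \<in> {0..2*pi} - N \<Longrightarrow>
      (\<lambda>t. ln (cmod (f t + cis b * g t))) integrable_on {0..2*pi} \<and>
      (\<lambda>t. ln (cmod (f' t + cis b * g' t))) integrable_on {0..2*pi} \<and>
      integral {0..2*pi} (\<lambda>t. ln (cmod (f t + cis b * g t))) \<le> integral {0..2*pi} (\<lambda>t. ln (cmod (f' t + cis b * g' t)))"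
  shows "integral {0..2*pi} (\<lambda>t. ln (max (cmod (f t)) (cmod (g t))))
    \<le> integral {0..2*pi} (\<lambda>t. ln (max (cmod (f' t)) (cmod (g' t))))"
proof -
  let ?D = "{0..2*pi}"
  define s where "s t = cmod (f t) + cmod (g t) + (cmod (f' t) + cmod (g' t))" for t
  have "continuous_on ?D s"
    unfolding s_def by (intro continuous_intros continuous_on_subset[OF cont(1)] continuous_on_subset[OF cont(2)]
        continuous_on_subset[OF cont(3)] continuous_on_subset[OF cont(4)]) auto
  then have "bounded (s ` ?D)" by (intro compact_imp_bounded compact_continuous_image) auto
  then obtain B where "\<And>t. t \<in> ?D \<Longrightarrow> norm (s t) \<le> B" by (metis bounded_iff imageI)
  then have B: "s t \<le> B" if "t \<in> ?D" for t using that by fastforce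
  define C where "C = max 1 B"
  have C: "C \<ge> 1" "\<And>t. t \<in> ?D \<Longrightarrow> s t \<le> C" using B by (auto simp: C_def intro!: max.coboundedI2)
  have C1: "cmod (f t) + cmod (g t) \<le> C" and C2: "cmod (f' t) + cmod (g' t) \<le> C" if "t \<in> ?D" for t
    using C(2)[OF that] unfolding s_def
    using norm_ge_zero[of "f t"] norm_ge_zero[of "g t"] norm_ge_zero[of "f' t"] norm_ge_zero[of "g' t"] by linarith+
  have inner: "(\<integral>\<^sup>+t. ennreal (indicator ?D b * (indicator ?D t * (ln C - ln (cmod (F t + cis b * G t))))) \<partial>lborel)
      = ennreal (indicator ?D b * (2*pi * ln C - integral ?D (\<lambda>t. ln (cmod (F t + cis b * G t)))))"
    if FG: "\<And>t. t \<in> ?D \<Longrightarrow> cmod (F t) + cmod (G t) \<le> C"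
      and "b \<in> ?D \<Longrightarrow> (\<lambda>t. ln (cmod (F t + cis b * G t))) integrable_on ?D" for F G b
  proof (cases "b \<in> ?D")
    case True
    have "((\<lambda>t. ln C - ln (cmod (F t + cis b * G t))) has_integral 2*pi * ln C - integral ?D (\<lambda>t. ln (cmod (F t + cis b * G t)))) ?D"
      by (intro has_integral_diff circle_const integrable_integral that True)
    moreover have "cmod (F t + cis b * G t) \<le> C" if "t \<in> ?D" for t
      using norm_triangle_ineq[of "F t" "cis b * G t"] FG[OF that] by (simp add: norm_mult)
    ultimately show ?thesis using nn_integral_interval[of _ _ ?D] ln_norm_le[OF _ C(1)] True by simp
  qed simp
  have "(\<integral>\<^sup>+b. (\<integral>\<^sup>+t. ennreal (indicator ?D b * (indicator ?D t * (ln C - ln (cmod (f' t + cis b * g' t))))) \<partial>lborel) \<partial>lborel)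
    \<le> (\<integral>\<^sup>+b. (\<integral>\<^sup>+t. ennreal (indicator ?D b * (indicator ?D t * (ln C - ln (cmod (f t + cis b * g t))))) \<partial>lborel) \<partial>lborel)"
  proof (rule nn_integral_mono_AE)
    show "AE b in lborel. (\<integral>\<^sup>+t. ennreal (indicator ?D b * (indicator ?D t * (ln C - ln (cmod (f' t + cis b * g' t))))) \<partial>lborel)
      \<le> (\<integral>\<^sup>+t. ennreal (indicator ?D b * (indicator ?D t * (ln C - ln (cmod (f t + cis b * g t))))) \<partial>lborel)"
      using AE_not_in_finite[OF N]
    proof eventually_elim
      fix b assume "b \<notin> N"
      then show "(\<integral>\<^sup>+t. ennreal (indicator ?D b * (indicator ?D t * (ln C - ln (cmod (f' t + cis b * g' t))))) \<partial>lborel)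
      \<le> (\<integral>\<^sup>+t. ennreal (indicator ?D b * (indicator ?D t * (ln C - ln (cmod (f t + cis b * g t))))) \<partial>lborel)"
        using le[of b] inner[where F=f and G=g and b=b, OF C1] inner[where F=f' and G=g' and b=b, OF C2]
        by (cases "b \<in> ?D") (auto intro!: ennreal_leI)
    qed
  qed
  then have "ennreal (2*pi * (2*pi * ln C - integral ?D (\<lambda>t. ln (max (cmod (f' t)) (cmod (g' t))))))
     \<le> ennreal (2*pi * (2*pi * ln C - integral ?D (\<lambda>t. ln (max (cmod (f t)) (cmod (g t))))))"
    using nn_log_average[OF cont(1,2) C(1) C1 fin(1) max(1)] nn_log_average[OF cont(3,4) C(1) C2 fin(2) max(2)]
    by simp
  moreover have "2*pi * (2*pi * ln C - integral ?D (\<lambda>t. ln (max (cmod (f t)) (cmod (g t))))) \<ge> 0"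
  proof -
    have "integral ?D (\<lambda>t. ln (max (cmod (f t)) (cmod (g t)))) \<le> 2*pi * ln C"
    proof (rule has_integral_le[OF integrable_integral[OF max(1)] circle_const])
      fix t assume "t \<in> ?D"
      then have "cmod (f t) \<le> C" "cmod (g t) \<le> C"
        using C1[of t] norm_ge_zero[of "f t"] norm_ge_zero[of "g t"] by linarith+
      then show "ln (max (cmod (f t)) (cmod (g t))) \<le> ln C" using ln_norm_le C(1) by (auto simp: max_def)
    qed
    then show ?thesis by simp
  qed
  ultimately have "2*pi * (2*pi * ln C - integral ?D (\<lambda>t. ln (max (cmod (f' t)) (cmod (g' t)))))
     \<le> 2*pi * (2*pi * ln C - integral ?D (\<lambda>t. ln (max (cmod (f t)) (cmod (g t)))))"
    by (simp only: ennreal_le_iff)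
  then show ?thesis by simp
qed

text \<open>
The identity \<open>x^p = p\<^sup>2 \<integral>\<^bsub>0\<^esub>\<^bsup>x\<^esup> s^(p-1) ln (x / s) ds\<close>: powers are positive superpositions of the
functions \<open>ln (max x s) - ln s\<close>.
\<close>

lemma power_as_log_integral:
  fixes x p :: real
  assumes x: "x \<ge> 0" and p: "p > 0"
  shows "(\<integral>\<^sup>+s. ennreal (indicator {0<..} s * (p\<^sup>2 * s powr (p - 1) * (ln (max x s) - ln s))) \<partial>lborel) = ennreal (x powr p)"
proof (cases "x = 0")
  case True
  then have eq: "indicator {0<..} s * (p\<^sup>2 * s powr (p - 1) * (ln (max x s) - ln s)) = 0" for s
    by (auto simp: indicator_def)
  show ?thesis unfolding eq using True by simp
next
  case False
  \<comment> \<open>An antiderivative of the integrand on \<open>(0, x)\<close>, obtained by integrating by parts.\<close>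
  define F where "F s = p * (s powr p * (ln x - ln s)) + s powr p" for s
  have "((\<lambda>s. p\<^sup>2 * s powr (p - 1) * (ln x - ln s)) has_integral (F x - F 0)) {0..x}"
  proof (rule fundamental_theorem_of_calculus_interior[OF x])
    show "continuous_on {0..x} F"
      unfolding continuous_on_eq_continuous_within
    proof
      fix s assume s: "s \<in> {0..x}"
      show "continuous (at s within {0..x}) F"
      proof (cases "s = 0")
        case True
        have "(F \<longlongrightarrow> 0) (at_right 0)" unfolding F_def using p by real_asymp
        moreover have "at 0 within {0..x} \<le> at_right (0::real)"
          by (rule order_trans[OF at_le[of _ "{0..}"]]) (auto simp: at_within_Ici_at_right)
        ultimately have "(F \<longlongrightarrow> 0) (at 0 within {0..x})" by (rule tendsto_mono[rotated])
        moreover have "F 0 = 0" by (simp add: F_def)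
        ultimately show ?thesis by (simp add: continuous_within True)
      next
        case False
        then have "isCont F s" unfolding F_def using s by (intro continuous_intros) auto
        then show ?thesis by (rule continuous_at_imp_continuous_at_within)
      qed
    qed
    fix s assume "s \<in> {0<..<x}"
    then have s: "s > 0" by simp
    have "(F has_real_derivative
       p * (p * s powr (p - 1) * (ln x - ln s) + s powr p * (0 - 1 / s)) + p * s powr (p - 1)) (at s)"
      unfolding F_def using s by (auto intro!: derivative_eq_intros)
    moreover have "p * s powr p / s = p * s powr (p - 1)" using s by (simp add: powr_diff)
    ultimately have "(F has_real_derivative p\<^sup>2 * s powr (p - 1) * (ln x - ln s)) (at s)"
      by (simp add: algebra_simps power2_eq_square)
    then show "(F has_vector_derivative p\<^sup>2 * s powr (p - 1) * (ln x - ln s)) (at s)"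
      by (simp add: has_real_derivative_iff_has_vector_derivative)
  qed
  then have I: "((\<lambda>s. p\<^sup>2 * s powr (p - 1) * (ln x - ln s)) has_integral x powr p) {0..x}"
    by (simp add: F_def)
  have eq: "indicator {0<..} s * (p\<^sup>2 * s powr (p - 1) * (ln (max x s) - ln s))
      = indicator {0..x} s * (p\<^sup>2 * s powr (p - 1) * (ln x - ln s))" for s
    by (auto simp: indicator_def max_def)
  have "p\<^sup>2 * s powr (p - 1) * (ln x - ln s) \<ge> 0" if "s \<in> {0..x}" for s
  proof (cases "s = 0")
    case False
    then have "ln s \<le> ln x" using that by (intro ln_mono) auto
    then show ?thesis by simp
  qed simp
  then show ?thesis unfolding eq by (rule nn_integral_interval[OF I])
qed

lemma power_integral_as_log_integral:
  fixes u :: "real \<Rightarrow> real"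
  assumes u: "continuous_on UNIV u" "\<And>t. u t \<ge> 0" and p: "p > 0"
  shows "(\<integral>\<^sup>+s. ennreal (indicator {0<..} s * (p\<^sup>2 * s powr (p - 1) *
      (integral {0..2*pi} (\<lambda>t. ln (max (u t) s)) - 2*pi * ln s))) \<partial>lborel)
    = ennreal (integral {0..2*pi} (\<lambda>t. u t powr p))"
proof -
  let ?D = "{0..2*pi}"
  have [measurable]: "u \<in> borel_measurable borel" using u(1) by (rule borel_measurable_continuous_onI)
  have uD: "continuous_on ?D u" using u(1) continuous_on_subset by blast
  let ?k = "\<lambda>t s. indicator {0<..} s * (indicator ?D t * (p\<^sup>2 * s powr (p - 1) * (ln (max (u t) s) - ln s)))"
  have "(\<integral>\<^sup>+s. ennreal (indicator {0<..} s * (p\<^sup>2 * s powr (p - 1) *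
      (integral ?D (\<lambda>t. ln (max (u t) s)) - 2*pi * ln s))) \<partial>lborel)
    = (\<integral>\<^sup>+s. (\<integral>\<^sup>+t. ennreal (?k t s) \<partial>lborel) \<partial>lborel)"
  proof (rule nn_integral_cong)
    fix s :: real
    show "ennreal (indicator {0<..} s * (p\<^sup>2 * s powr (p - 1) * (integral ?D (\<lambda>t. ln (max (u t) s)) - 2*pi * ln s)))
      = (\<integral>\<^sup>+t. ennreal (?k t s) \<partial>lborel)"
    proof (cases "s > 0")
      case True
      have "continuous_on ?D (\<lambda>t. ln (max (u t) s))"
        by (intro continuous_intros uD) (use True in \<open>auto simp: max_def split: if_splits\<close>)
      then have "(\<lambda>t. ln (max (u t) s)) integrable_on ?D" by (rule integrable_continuous_interval)
      then have I: "((\<lambda>t. p\<^sup>2 * s powr (p - 1) * (ln (max (u t) s) - ln s)) has_integral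
         p\<^sup>2 * s powr (p - 1) * (integral ?D (\<lambda>t. ln (max (u t) s)) - 2*pi * ln s)) ?D"
        by (intro has_integral_mult_right has_integral_diff circle_const integrable_integral)
      have "ln s \<le> ln (max (u t) s)" for t using True by (intro ln_mono) auto
      then have "p\<^sup>2 * s powr (p - 1) * (ln (max (u t) s) - ln s) \<ge> 0" for t by simp
      then show ?thesis using nn_integral_interval[OF I] True by simp
    qed simp
  qed
  also have "\<dots> = (\<integral>\<^sup>+t. (\<integral>\<^sup>+s. ennreal (?k t s) \<partial>lborel) \<partial>lborel)"
    by (rule lborel_pair.Fubini') measurable
  also have "\<dots> = (\<integral>\<^sup>+t. ennreal (indicator ?D t * u t powr p) \<partial>lborel)"
  proof (rule nn_integral_cong)
    fix t :: real
    show "(\<integral>\<^sup>+s. ennreal (?k t s) \<partial>lborel) = ennreal (indicator ?D t * u t powr p)"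
      using power_as_log_integral[OF u(2) p, of t] by (cases "t \<in> ?D") auto
  qed
  also have "\<dots> = ennreal (integral ?D (\<lambda>t. u t powr p))"
  proof (rule nn_integral_interval)
    have "continuous_on ?D (\<lambda>t. u t powr p)"
      by (rule continuous_on_powr') (use u p in \<open>auto intro: uD\<close>)
    then show "((\<lambda>t. u t powr p) has_integral integral ?D (\<lambda>t. u t powr p)) ?D"
      by (intro integrable_integral integrable_continuous_interval)
  qed simp
  finally show ?thesis .
qed

lemma power_integral_mono:
  fixes u v :: "real \<Rightarrow> real"
  assumes "continuous_on UNIV u" "\<And>t. u t \<ge> 0" "continuous_on UNIV v" "\<And>t. v t \<ge> 0" and p: "p > 0"
    and le: "\<And>s. s > 0 \<Longrightarrow> integral {0..2*pi} (\<lambda>t. ln (max (u t) s)) \<le> integral {0..2*pi} (\<lambda>t. ln (max (v t) s))"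
  shows "integral {0..2*pi} (\<lambda>t. u t powr p) \<le> integral {0..2*pi} (\<lambda>t. v t powr p)"
proof -
  have "ennreal (integral {0..2*pi} (\<lambda>t. u t powr p)) \<le> ennreal (integral {0..2*pi} (\<lambda>t. v t powr p))"
    unfolding power_integral_as_log_integral[OF assms(1,2) p, symmetric]
      power_integral_as_log_integral[OF assms(3,4) p, symmetric]
    using le by (intro nn_integral_mono ennreal_leI) (auto simp: indicator_def intro!: mult_left_mono)
  moreover have "integral {0..2*pi} (\<lambda>t. v t powr p) \<ge> 0"
  proof (rule integral_nonneg)
    have "continuous_on {0..2*pi} (\<lambda>t. v t powr p)"
      by (rule continuous_on_powr') (use assms in \<open>auto intro: continuous_on_subset\<close>)
    then show "(\<lambda>t. v t powr p) integrable_on {0..2*pi}" by (rule integrable_continuous_interval)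
  qed simp
  ultimately show ?thesis by simp
qed

lemma continuous_poly_cis: "continuous_on S (\<lambda>t. poly P (cis t))"
  by (intro continuous_intros)

text \<open>
Apply the inequality for logarithmic means to \<open>P + e^(ib) r z^n\<close>. The added
term is multiplied by \<open>g n\<close> and has constant modulus \<open>s = |g n r|\<close> on the circle, both in the image
and in \<open>g n (P + e^(ib) r z^n)\<close>, so averaging over \<open>b\<close> gives the inequality between the means of
\<open>ln (max u s)\<close> for every \<open>s > 0\<close>.
\<close>

theorem Arestov:
  assumes g: "admissible n g" and P: "degree P \<le> n" and p: "p > 0"
  shows "integral {0..2*pi} (\<lambda>t. cmod (poly (multiplier n g P) (cis t)) powr p)
    \<le> integral {0..2*pi} (\<lambda>t. cmod (g n * poly P (cis t)) powr p)"
proof (rule power_integral_mono[OF _ _ _ _ p])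
  let ?D = "{0..2*pi}"
  fix s :: real assume s: "s > 0"
  have gn: "g n \<noteq> 0" by (rule admissible_coeff[OF g])
  define r where "r = complex_of_real (s / cmod (g n))"
  have r: "cmod (g n * r) = s" "r \<noteq> 0" using gn s by (auto simp: r_def norm_mult norm_divide)
  define f f' h where "f = (\<lambda>t. poly (multiplier n g P) (cis t))" and "f' = (\<lambda>t. g n * poly P (cis t))"
    and "h = (\<lambda>t. g n * r * cis t ^ n)"
  have h: "cmod (h t) = s" for t unfolding h_def norm_mult[of _ "cis t ^ n"] r(1) by (simp add: norm_power)
  have h0: "h t \<noteq> 0" for t using h[of t] s by auto
  \<comment> \<open>Away from this set the leading coefficient of \<open>P + e^(ib) r z^n\<close> is nonzero, so its image is too.\<close>
  define N where "N = {b\<in>?D. cis b = - coeff P n / r}"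
  have lnmax: "(\<lambda>t. ln (max (cmod (F t)) (cmod (h t)))) integrable_on ?D" if "continuous_on ?D F" for F
    unfolding h using s by (intro integrable_continuous_interval continuous_intros that) (auto simp: max_def split: if_splits)
  have "integral ?D (\<lambda>t. ln (max (cmod (f t)) (cmod (h t)))) \<le> integral ?D (\<lambda>t. ln (max (cmod (f' t)) (cmod (h t))))"
  proof (rule log_average_mono)
    show "continuous_on UNIV f" "continuous_on UNIV f'" "continuous_on UNIV h" "continuous_on UNIV h"
      unfolding f_def f'_def h_def by (intro continuous_intros)+
    show "finite {t\<in>?D. f t = 0 \<and> h t = 0}" "finite {t\<in>?D. f' t = 0 \<and> h t = 0}" by (auto simp: h0)
    show "(\<lambda>t. ln (max (cmod (f t)) (cmod (h t)))) integrable_on ?D"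
      "(\<lambda>t. ln (max (cmod (f' t)) (cmod (h t)))) integrable_on ?D"
      by (rule lnmax; unfold f_def f'_def; intro continuous_intros)+
    show "finite N" unfolding N_def by (rule finite_cis_eq)
    fix b assume b: "b \<in> ?D - N"
    define Q where "Q = P + monom (cis b * r) n"
    have dQ: "degree Q \<le> n" unfolding Q_def using P by (intro degree_add_le) (auto intro: degree_monom_le)
    have gQ: "multiplier n g Q = multiplier n g P + monom (g n * (cis b * r)) n"
      by (simp add: Q_def multiplier_add multiplier_monom)
    have Qn: "coeff Q n \<noteq> 0"
      using b r(2) by (auto simp: Q_def N_def field_simps add_eq_0_iff)
    then have nz: "multiplier n g Q \<noteq> 0" "smult (g n) Q \<noteq> 0" using gn
      by (metis coeff_0 coeff_multiplier mult_eq_0_iff order_refl, metis coeff_0 smult_eq_0_iff)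
    have f: "f t + cis b * h t = poly (multiplier n g Q) (cis t)" for t
      by (simp add: f_def h_def gQ poly_monom)
    have f': "f' t + cis b * h t = poly (smult (g n) Q) (cis t)" for t
      by (simp add: f'_def h_def Q_def poly_monom algebra_simps)
    show "(\<lambda>t. ln (cmod (f t + cis b * h t))) integrable_on ?D \<and>
      (\<lambda>t. ln (cmod (f' t + cis b * h t))) integrable_on ?D \<and>
      integral ?D (\<lambda>t. ln (cmod (f t + cis b * h t))) \<le> integral ?D (\<lambda>t. ln (cmod (f' t + cis b * h t)))"
      unfolding f f'
      using log_integrable_poly[OF nz(1)] log_integrable_poly[OF nz(2)] Mahler_multiplier[OF g dQ nz(1)] by simp
  qed
  then show "integral ?D (\<lambda>t. ln (max (cmod (poly (multiplier n g P) (cis t))) s))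
     \<le> integral ?D (\<lambda>t. ln (max (cmod (g n * poly P (cis t))) s))"
    unfolding h f_def f'_def .
qed (auto intro!: continuous_intros)

section \<open>Polynomials without zeros in the open disc\<close>

text \<open>
The conjugate reciprocal of \<open>P\<close> has its zeros in the disc and dominates \<open>P\<close> outside, so its image
dominates the image of \<open>P\<close>; taking the conjugate reciprocal of that image does not change
the modulus on the circle.
\<close>

lemma nonvanishing_dominated:
  assumes g: "admissible n g" and P: "degree P \<le> n" "\<And>z. cmod z < 1 \<Longrightarrow> poly P z \<noteq> 0"
    and z: "cmod z = 1"
  shows "cmod (poly (multiplier n g P) z)
    \<le> cmod (poly (conj_reciprocal n (multiplier n g (conj_reciprocal n P))) z)"
proof -
  define Q where "Q = conj_reciprocal n P"
  have PQ: "P = conj_reciprocal n Q" by (simp add: Q_def conj_reciprocal_twice P(1))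
  have Q: "disc_zeros n Q"
  proof (rule disc_zerosI)
    show "degree Q \<le> n" by (simp add: Q_def degree_conj_reciprocal)
    show "coeff Q n \<noteq> 0" using P(2)[of 0] by (simp add: Q_def coeff_conj_reciprocal poly_0_coeff_0)
    fix z :: complex assume z: "cmod z > 1"
    then have "cmod (1 / cnj z) < 1" "z \<noteq> 0" by (auto simp: norm_divide divide_less_eq)
    then show "poly Q z \<noteq> 0" using P(2)[of "1 / cnj z"] by (simp add: Q_def poly_conj_reciprocal P(1))
  qed
  have "cmod (poly (multiplier n g P) z) \<le> cmod (poly (multiplier n g Q) z)"
    by (rule multiplier_dominated[OF g Q P(1)])
       (use z PQ norm_conj_reciprocal_outside[OF Q] in auto)
  then show ?thesis
    using z by (simp add: norm_conj_reciprocal_circle degree_multiplier Q_def)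
qed

text \<open>
After scaling, this says that \<open>|1 + r e^(it)|\<close> is smallest at \<open>r = 1\<close> among \<open>r \<ge> 1\<close>: the derivative
of its square with respect to \<open>r\<close> is \<open>2 (r + cos t) \<ge> 0\<close>.
\<close>

lemma norm_linear_cis_ge:
  assumes "0 \<le> a" "a \<le> b"
  shows "a * cmod (1 + cis t) \<le> cmod (of_real a + of_real b * cis t)"
proof (rule power2_le_imp_le)
  have sq: "(cmod (of_real u + of_real v * cis t))\<^sup>2 = u\<^sup>2 + 2 * u * v * cos t + v\<^sup>2" for u v
  proof -
    have "(u + v * cos t)\<^sup>2 + (v * sin t)\<^sup>2 = u\<^sup>2 + 2 * u * v * cos t + v\<^sup>2"
      using sin_cos_squared_add[of t] by algebra
    then show ?thesis by (simp only: cmod_power2, simp)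
  qed
  have "(cmod (of_real a + of_real b * cis t))\<^sup>2 - (a * cmod (1 + cis t))\<^sup>2
      = (b - a) * ((b - a) + 2 * a * (1 + cos t))"
    using sq[of a b] sq[of 1 1] by (simp add: power_mult_distrib power2_eq_square algebra_simps)
  also have "\<dots> \<ge> 0"
  proof -
    have "0 \<le> 2 * a * (1 + cos t)"
      using assms cos_ge_minus_one[of t] by (intro mult_nonneg_nonneg[of "2 * a" "1 + cos t"]) linarith+
    then show ?thesis using assms by (intro mult_nonneg_nonneg) auto
  qed
  finally show "(a * cmod (1 + cis t))\<^sup>2 \<le> (cmod (of_real a + of_real b * cis t))\<^sup>2" by simp
qed simp

lemma power_integrable:
  fixes f :: "real \<Rightarrow> complex"
  assumes "continuous_on {0..2*pi} f" "p > 0"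
  shows "(\<lambda>t. cmod (f t) powr p) integrable_on {0..2*pi}"
  by (intro integrable_continuous_interval continuous_on_powr' continuous_intros assms(1))
     (use assms(2) in auto)

lemma power_average_ge:
  assumes p: "p > 0" and le: "cmod a \<le> cmod b"
  shows "cmod a powr p * integral {0..2*pi} (\<lambda>t. cmod (1 + cis t) powr p)
    \<le> integral {0..2*pi} (\<lambda>t. cmod (a + cis t * b) powr p)"
proof -
  let ?D = "{0..2*pi}"
  have i: "(\<lambda>t. cmod (of_real (cmod a) + of_real (cmod b) * cis t) powr p) integrable_on ?D"
    "(\<lambda>t. cmod (1 + cis t) powr p) integrable_on ?D"
    by (intro power_integrable continuous_intros p)+
  have "((\<lambda>t. cmod (a + b * cis t) powr p) has_integral
      integral ?D (\<lambda>t. cmod (of_real (cmod a) + of_real (cmod b) * cis t) powr p)) ?D"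
    by (rule circle_linear_cong[where f="\<lambda>x. x powr p", OF integrable_integral[OF i(1)]]) auto
  then have "integral ?D (\<lambda>t. cmod (a + cis t * b) powr p)
     = integral ?D (\<lambda>t. cmod (of_real (cmod a) + of_real (cmod b) * cis t) powr p)"
    by (simp add: integral_unique mult.commute)
  also have "\<dots> \<ge> integral ?D (\<lambda>t. cmod a powr p * cmod (1 + cis t) powr p)"
  proof (rule integral_le)
    show "(\<lambda>t. cmod a powr p * cmod (1 + cis t) powr p) integrable_on ?D"
      using i(2) by (rule integrable_on_mult_right)
    fix t
    show "cmod a powr p * cmod (1 + cis t) powr p \<le> cmod (of_real (cmod a) + of_real (cmod b) * cis t) powr p"
      using powr_mono2[OF _ _ norm_linear_cis_ge[OF norm_ge_zero le, of t], of p] p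
      by (simp add: powr_mult)
  qed (rule i(1))
  finally show ?thesis by simp
qed

text \<open>
Write \<open>F\<close> for the image of \<open>P\<close> and \<open>H\<close> for the polynomial that dominates it on the circle.
Fixing the point of the circle and integrating \<open>|F + e^(ib) H|^p\<close> over \<open>b\<close> gives at least
\<open>|F|^p\<close> times the integral of \<open>|1 + e^(ib)|^p\<close>; fixing \<open>b\<close> and integrating over the circle,
Arestov's inequality applies, since \<open>F + e^(ib) H\<close> is the image of \<open>P\<close> under the
symmetrized multiplier.
\<close>

lemma power_integral_nonvanishing:
  assumes g: "admissible n g" and g0: "cmod (g 0) < cmod (g n)"
    and P: "degree P \<le> n" "\<And>z. cmod z < 1 \<Longrightarrow> poly P z \<noteq> 0" and p: "p > 0"
  shows "integral {0..2*pi} (\<lambda>t. cmod (poly (multiplier n g P) (cis t)) powr p)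
      * integral {0..2*pi} (\<lambda>t. cmod (1 + cis t) powr p)
    \<le> integral {0..2*pi} (\<lambda>t. cmod (g 0 + g n * cis t) powr p)
      * integral {0..2*pi} (\<lambda>t. cmod (poly P (cis t)) powr p)"
proof -
  let ?D = "{0..2*pi}"
  let ?W = "integral ?D (\<lambda>t. cmod (1 + cis t) powr p)"
  define F where "F = (\<lambda>t. poly (multiplier n g P) (cis t))"
  define H where "H = (\<lambda>t. poly (conj_reciprocal n (multiplier n g (conj_reciprocal n P))) (cis t))"
  have le: "cmod (F t) \<le> cmod (H t)" for t
    unfolding F_def H_def by (rule nonvanishing_dominated[OF g P]) auto
  have contF: "continuous_on S F" and contH: "continuous_on S H" for S
    unfolding F_def H_def by (rule continuous_poly_cis)+
  have cont2: "continuous_on (cbox (0, 0) (2*pi, 2*pi)) (\<lambda>(t, b). cmod (F t + cis b * H t) powr p)"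
    unfolding split_def
    by (intro continuous_on_powr' continuous_intros continuous_on_compose2[OF contF[of UNIV]] continuous_on_compose2[OF contH[of UNIV]])
       (use p in auto)
  have "continuous_on (cbox (0, 0) (2*pi, 2*pi)) (\<lambda>(b, t). cmod (F t + cis b * H t) powr p)"
    unfolding split_def
    by (intro continuous_on_powr' continuous_intros continuous_on_compose2[OF contF[of UNIV]] continuous_on_compose2[OF contH[of UNIV]])
       (use p in auto)
  then have cont_b: "continuous_on ?D (\<lambda>b. integral (cbox 0 (2*pi)) (\<lambda>t. cmod (F t + cis b * H t) powr p))"
    by (intro integral_continuous_on_param) (simp add: cbox_Pair_eq)
  have cont_t: "continuous_on ?D (\<lambda>t. integral (cbox 0 (2*pi)) (\<lambda>b. cmod (F t + cis b * H t) powr p))"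
    using cont2 by (intro integral_continuous_on_param) (simp add: cbox_Pair_eq)
  have iF: "(\<lambda>t. cmod (F t) powr p) integrable_on ?D" by (rule power_integrable[OF contF p])
  have i\<gamma>: "(\<lambda>b. cmod (g n + cnj (g 0) * cis b) powr p) integrable_on ?D"
    by (intro power_integrable continuous_intros p)
  have "integral ?D (\<lambda>t. cmod (F t) powr p) * ?W = integral ?D (\<lambda>t. cmod (F t) powr p * ?W)"
    by simp
  also have "\<dots> \<le> integral ?D (\<lambda>t. integral ?D (\<lambda>b. cmod (F t + cis b * H t) powr p))"
    by (rule integral_le[OF integrable_on_mult_left[OF iF] integrable_continuous_interval power_average_ge[OF p le]])
       (use cont_t in simp)
  also have "\<dots> = integral ?D (\<lambda>b. integral ?D (\<lambda>t. cmod (F t + cis b * H t) powr p))"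
    using integral_swap_continuous[OF cont2] by simp
  also have "\<dots> \<le> integral ?D (\<lambda>b. cmod (g n + cnj (g 0) * cis b) powr p * integral ?D (\<lambda>t. cmod (poly P (cis t)) powr p))"
  proof (rule integral_le)
    show "(\<lambda>b. integral ?D (\<lambda>t. cmod (F t + cis b * H t) powr p)) integrable_on ?D"
      using cont_b by (intro integrable_continuous_interval) simp
    show "(\<lambda>b. cmod (g n + cnj (g 0) * cis b) powr p * integral ?D (\<lambda>t. cmod (poly P (cis t)) powr p)) integrable_on ?D"
      by (rule integrable_on_mult_left[OF i\<gamma>])
    fix b
    have "F t + cis b * H t = poly (multiplier n (\<lambda>k. g k + cis b * cnj (g (n - k))) P) (cis t)" for t
      by (simp add: multiplier_symmetrized F_def H_def)
    then show "integral ?D (\<lambda>t. cmod (F t + cis b * H t) powr p)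
       \<le> cmod (g n + cnj (g 0) * cis b) powr p * integral ?D (\<lambda>t. cmod (poly P (cis t)) powr p)"
      using Arestov[OF admissible_symmetrized[OF g g0, of "cis b"] P(1) p]
      by (simp add: norm_mult powr_mult mult.commute)
  qed
  also have "\<dots> = integral ?D (\<lambda>b. cmod (g n + cnj (g 0) * cis b) powr p) * integral ?D (\<lambda>t. cmod (poly P (cis t)) powr p)"
    by simp
  also have "integral ?D (\<lambda>b. cmod (g n + cnj (g 0) * cis b) powr p) = integral ?D (\<lambda>t. cmod (g 0 + g n * cis t) powr p)"
  proof -
    have "((\<lambda>t. cmod (cnj (g 0) + g n * cis t) powr p) has_integral integral ?D (\<lambda>b. cmod (g n + cnj (g 0) * cis b) powr p)) ?D"
      by (rule circle_linear_swap[where f="\<lambda>x. x powr p", OF integrable_integral[OF i\<gamma>]])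
    then have "((\<lambda>t. cmod (g 0 + g n * cis t) powr p) has_integral integral ?D (\<lambda>b. cmod (g n + cnj (g 0) * cis b) powr p)) ?D"
      by (rule circle_linear_cong[where f="\<lambda>x. x powr p"]) auto
    then show ?thesis by (simp add: integral_unique)
  qed
  finally show ?thesis by (simp add: F_def)
qed

text \<open>
The same double average with logarithms in place of powers. Here averaging over \<open>b\<close> gives
\<open>ln |H|\<close> on the left, which is at least \<open>ln |F|\<close>, and \<open>ln |g n P|\<close> on the right.
\<close>

lemma log_integral_nonvanishing:
  assumes g: "admissible n g" and g0: "cmod (g 0) < cmod (g n)"
    and P: "degree P \<le> n" "\<And>z. cmod z < 1 \<Longrightarrow> poly P z \<noteq> 0" and nz: "multiplier n g P \<noteq> 0"
  shows "integral {0..2*pi} (\<lambda>t. ln (cmod (poly (multiplier n g P) (cis t))))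
    \<le> 2*pi * ln (cmod (g n)) + integral {0..2*pi} (\<lambda>t. ln (cmod (poly P (cis t))))"
proof -
  let ?D = "{0..2*pi}"
  have gn: "g n \<noteq> 0" by (rule admissible_coeff[OF g])
  have P0: "coeff P 0 \<noteq> 0" using P(2)[of 0] by (simp add: poly_0_coeff_0)
  then have Pnz: "P \<noteq> 0" by auto
  define HP where "HP = conj_reciprocal n (multiplier n g (conj_reciprocal n P))"
  define F H where "F = (\<lambda>t. poly (multiplier n g P) (cis t))" and "H = (\<lambda>t. poly HP (cis t))"
  have "coeff HP 0 \<noteq> 0" using P0 gn by (simp add: HP_def coeff_conj_reciprocal coeff_multiplier)
  then have HP: "HP \<noteq> 0" by auto
  have le: "cmod (F t) \<le> cmod (H t)" for t
    unfolding F_def H_def HP_def by (rule nonvanishing_dominated[OF g P]) auto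
  then have max: "max (cmod (F t)) (cmod (H t)) = cmod (H t)" for t by (rule max_absorb2)
  define f h where "f = (\<lambda>t. g n * poly P (cis t))" and "h = (\<lambda>t. cnj (g 0) * poly P (cis t))"
  have "cmod (h t) \<le> cmod (f t)" for t
    unfolding f_def h_def norm_mult using g0 by (intro mult_right_mono) auto
  then have max': "max (cmod (f t)) (cmod (h t)) = cmod (poly (smult (g n) P) (cis t))" for t
    by (simp add: max_absorb1 f_def)
  have zeros: "f t = 0 \<longleftrightarrow> poly P (cis t) = 0" for t using gn by (simp add: f_def)
  have "integral ?D (\<lambda>t. ln (max (cmod (F t)) (cmod (H t)))) \<le> integral ?D (\<lambda>t. ln (max (cmod (f t)) (cmod (h t))))"
  proof (rule log_average_mono)
    show "continuous_on UNIV F" "continuous_on UNIV H" "continuous_on UNIV f" "continuous_on UNIV h"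
      unfolding F_def H_def f_def h_def by (intro continuous_intros)+
    show "finite {t\<in>?D. F t = 0 \<and> H t = 0}"
      by (rule finite_subset[OF _ finite_poly_cis_zeros[OF HP]]) (auto simp: H_def)
    show "finite {t\<in>?D. f t = 0 \<and> h t = 0}"
      by (rule finite_subset[OF _ finite_poly_cis_zeros[OF Pnz]]) (auto simp: zeros)
    show "(\<lambda>t. ln (max (cmod (F t)) (cmod (H t)))) integrable_on ?D"
      unfolding max unfolding H_def by (rule log_integrable_poly[OF HP])
    show "(\<lambda>t. ln (max (cmod (f t)) (cmod (h t)))) integrable_on ?D"
      unfolding max' by (rule log_integrable_poly) (use gn Pnz in simp)
    show "finite {}" by simp
    fix b assume "b \<in> ?D - {}"
    define \<gamma> where "\<gamma> k = g k + cis b * cnj (g (n - k))" for k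
    have \<gamma>: "admissible n \<gamma>" unfolding \<gamma>_def by (rule admissible_symmetrized[OF g g0]) simp
    \<comment> \<open>The constant term of the image survives for every \<open>b\<close>, so the exceptional set is empty.\<close>
    have "\<gamma> 0 \<noteq> 0"
    proof
      assume "\<gamma> 0 = 0"
      then have "cmod (g 0) = cmod (cis b * cnj (g n))"
        by (metis \<gamma>_def add_eq_0_iff2 diff_zero norm_minus_cancel)
      then show False using g0 by (simp add: norm_mult)
    qed
    then have "coeff (multiplier n \<gamma> P) 0 \<noteq> 0" using P0 by (simp add: coeff_multiplier)
    then have nz: "multiplier n \<gamma> P \<noteq> 0" by auto
    have 1: "F t + cis b * H t = poly (multiplier n \<gamma> P) (cis t)" for t
      unfolding \<gamma>_def multiplier_symmetrized by (simp add: F_def H_def HP_def)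
    have 2: "f t + cis b * h t = poly (smult (\<gamma> n) P) (cis t)" for t
      by (simp add: f_def h_def \<gamma>_def algebra_simps)
    have "smult (\<gamma> n) P \<noteq> 0" using admissible_coeff[OF \<gamma>] Pnz by simp
    then show "(\<lambda>t. ln (cmod (F t + cis b * H t))) integrable_on ?D \<and>
      (\<lambda>t. ln (cmod (f t + cis b * h t))) integrable_on ?D \<and>
      integral ?D (\<lambda>t. ln (cmod (F t + cis b * H t))) \<le> integral ?D (\<lambda>t. ln (cmod (f t + cis b * h t)))"
      unfolding 1 2
      using log_integrable_poly[OF nz] log_integrable_poly[of "smult (\<gamma> n) P"] Mahler_multiplier[OF \<gamma> P(1) nz]
      by simp
  qed
  then have "integral ?D (\<lambda>t. ln (cmod (H t))) \<le> integral ?D (\<lambda>t. ln (cmod (poly (smult (g n) P) (cis t))))"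
    unfolding max max' .
  moreover have "integral ?D (\<lambda>t. ln (cmod (F t))) \<le> integral ?D (\<lambda>t. ln (cmod (H t)))"
  proof (rule integral_le_except_finite[OF _ _ finite_poly_cis_zeros[OF nz]])
    show "(\<lambda>t. ln (cmod (F t))) integrable_on ?D" "(\<lambda>t. ln (cmod (H t))) integrable_on ?D"
      unfolding F_def H_def using log_integrable_poly nz HP by blast+
    show "ln (cmod (F t)) \<le> ln (cmod (H t))" if "t \<in> ?D - {t\<in>?D. poly (multiplier n g P) (cis t) = 0}" for t
      using le[of t] that by (intro ln_mono) (auto simp: F_def)
  qed
  moreover have "((\<lambda>t. ln (cmod (poly (smult (g n) P) (cis t)))) has_integral
     2*pi * ln (cmod (g n)) + integral ?D (\<lambda>t. ln (cmod (poly P (cis t))))) ?D"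
  proof (rule has_integral_spike_finite[OF finite_poly_cis_zeros[OF Pnz]])
    show "((\<lambda>t. ln (cmod (g n)) + ln (cmod (poly P (cis t)))) has_integral
     2*pi * ln (cmod (g n)) + integral ?D (\<lambda>t. ln (cmod (poly P (cis t))))) ?D"
      by (intro has_integral_add circle_const integrable_integral log_integrable_poly Pnz)
  qed (use gn in \<open>auto simp: norm_mult ln_mult_pos\<close>)
  ultimately show ?thesis by (simp add: F_def integral_unique)
qed

section \<open>The norms\<close>

lemma circle_norm_pos_exponent:
  assumes "p \<noteq> 0"
  shows "circle_norm p Q = (1 / (2*pi) * integral {0..2*pi} (\<lambda>t. cmod (poly Q (cis t)) powr p)) powr (1 / p)"
  using assms by (simp add: circle_norm_def)

lemma circle_norm_zero_linear:
  assumes "a \<noteq> 0 \<or> b \<noteq> 0"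
  shows "circle_norm 0 [:a, b:] = max (cmod a) (cmod b)"
proof -
  have "integral {0..2*pi} (\<lambda>t. ln (cmod (poly [:a, b:] (cis t)))) = 2*pi * ln (max (cmod a) (cmod b))"
    using Jensen_linear[OF assms] by (simp add: integral_unique mult.commute)
  moreover have "max (cmod a) (cmod b) > 0" using assms by (auto simp: less_max_iff_disj)
  ultimately show ?thesis using assms by (auto simp: circle_norm_def)
qed

text \<open>
The map \<open>z \<mapsto> z^n\<close> preserves the normalised measure of the circle.
\<close>

lemma circle_norm_binomial:
  assumes n: "n \<ge> 1" and p: "p \<ge> 0" and x: "x \<noteq> 0" and ab: "cmod a = cmod x" "cmod b = cmod y"
  shows "circle_norm p (monom a n + [:b:]) = circle_norm p [:y, x:]"
proof -
  let ?D = "{0..2*pi}"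
  have transfer: "integral ?D (\<lambda>t. \<phi> (cmod (poly (monom a n + [:b:]) (cis t)))) = integral ?D (\<lambda>t. \<phi> (cmod (poly [:y, x:] (cis t))))"
    if "(\<lambda>t. \<phi> (cmod (y + x * cis t))) integrable_on ?D" for \<phi> :: "real \<Rightarrow> real"
  proof -
    have "((\<lambda>t. \<phi> (cmod (b + a * cis t))) has_integral integral ?D (\<lambda>t. \<phi> (cmod (y + x * cis t)))) ?D"
      by (rule circle_linear_cong[OF integrable_integral[OF that]]) (use ab in auto)
    from circle_power[of "\<lambda>z. \<phi> (cmod (b + a * z))", OF this n]
    show ?thesis by (simp add: integral_unique poly_monom add.commute mult.commute)
  qed
  show ?thesis
  proof (cases "p = 0")
    case True
    have "monom a n + [:b:] \<noteq> 0"
    proof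
      assume "monom a n + [:b:] = 0"
      then have "coeff (monom a n + [:b:]) n = 0" by simp
      then show False using n x ab by (auto simp: coeff_pCons split: nat.splits)
    qed
    moreover have "(\<lambda>t. ln (cmod (y + x * cis t))) integrable_on ?D"
      using Jensen_linear[of y x] x by (auto simp: integrable_on_def)
    ultimately show ?thesis using transfer[of ln] x True by (simp add: circle_norm_def)
  next
    case False
    have "(\<lambda>t. cmod (y + x * cis t) powr p) integrable_on ?D"
      by (intro power_integrable continuous_intros) (use False p in simp)
    then show ?thesis using transfer[of "\<lambda>u. u powr p"] False by (simp add: circle_norm_def)
  qed
qed

lemma power_integral_nonneg: "integral {0..2*pi} (\<lambda>t. cmod (poly Q (cis t)) powr p) \<ge> 0" if "p > 0"
  using power_integrable[OF continuous_poly_cis that] by (intro integral_nonneg) auto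

lemma power_integral_one_plus_pos:
  assumes "p > 0" shows "integral {0..2*pi} (\<lambda>t. cmod (1 + cis t) powr p) > 0"
proof -
  let ?D = "{0..2*pi}"
  have cont: "continuous_on ?D (\<lambda>t. cmod (1 + cis t) powr p)"
    by (rule continuous_on_powr') (use assms in \<open>auto intro!: continuous_intros\<close>)
  have "integral ?D (\<lambda>t. cmod (1 + cis t) powr p) \<noteq> 0"
    using integral_eq_0_iff[OF cont] by (auto dest!: bspec[of _ _ 0])
  moreover have "integral ?D (\<lambda>t. cmod (1 + cis t) powr p) \<ge> 0"
    by (rule integral_nonneg[OF integrable_continuous_interval[OF cont]]) simp
  ultimately show ?thesis by simp
qed

lemma circle_norm_one_plus_pos:
  assumes "p \<ge> 0" shows "circle_norm p [:1, 1:] > 0"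
proof (cases "p = 0")
  case True
  then show ?thesis by (simp add: circle_norm_zero_linear)
next
  case False
  then show ?thesis using power_integral_one_plus_pos[of p] assms by (simp add: circle_norm_def)
qed

theorem circle_norm_multiplier_nonvanishing:
  assumes g: "admissible n g" and g0: "cmod (g 0) < cmod (g n)"
    and P: "degree P \<le> n" "\<And>z. cmod z < 1 \<Longrightarrow> poly P z \<noteq> 0" and p: "p \<ge> 0"
  shows "circle_norm p (multiplier n g P)
    \<le> circle_norm p [:g 0, g n:] / circle_norm p [:1, 1:] * circle_norm p P"
proof (cases "p = 0")
  case True
  have gn: "g n \<noteq> 0" by (rule admissible_coeff[OF g])
  have P0: "P \<noteq> 0" using P(2)[of 0] by auto
  have N: "circle_norm 0 [:g 0, g n:] = cmod (g n)" "circle_norm 0 [:1, 1:] = 1"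
    using gn g0 by (simp_all add: circle_norm_zero_linear)
  show ?thesis
  proof (cases "multiplier n g P = 0")
    case True
    then show ?thesis using \<open>p = 0\<close> N P0 by (simp add: circle_norm_def)
  next
    case False
    have "1 / (2*pi) * integral {0..2*pi} (\<lambda>t. ln (cmod (poly (multiplier n g P) (cis t))))
       \<le> 1 / (2*pi) * (2*pi * ln (cmod (g n)) + integral {0..2*pi} (\<lambda>t. ln (cmod (poly P (cis t)))))"
      by (intro mult_left_mono log_integral_nonvanishing[OF g g0 P False]) auto
    then have "circle_norm 0 (multiplier n g P) \<le> exp (1 / (2*pi) * (2*pi * ln (cmod (g n)) + integral {0..2*pi} (\<lambda>t. ln (cmod (poly P (cis t))))))"
      using False by (simp add: circle_norm_def)
    also have "\<dots> = cmod (g n) * circle_norm 0 P"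
      using P0 gn by (simp add: circle_norm_def distrib_left exp_add)
    finally show ?thesis using N True by simp
  qed
next
  case False
  with p have p: "p > 0" by simp
  define A W G K where "A = 1 / (2*pi) * integral {0..2*pi} (\<lambda>t. cmod (poly (multiplier n g P) (cis t)) powr p)"
    and "W = 1 / (2*pi) * integral {0..2*pi} (\<lambda>t. cmod (poly [:1, 1:] (cis t)) powr p)"
    and "G = 1 / (2*pi) * integral {0..2*pi} (\<lambda>t. cmod (poly [:g 0, g n:] (cis t)) powr p)"
    and "K = 1 / (2*pi) * integral {0..2*pi} (\<lambda>t. cmod (poly P (cis t)) powr p)"
  have nonneg: "A \<ge> 0" "G \<ge> 0" "K \<ge> 0"
    unfolding A_def G_def K_def by (intro mult_nonneg_nonneg power_integral_nonneg[OF p]; simp)+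
  have W: "W > 0" using power_integral_one_plus_pos[OF p] by (simp add: W_def)
  have "A * W = 1 / (2*pi)^2 * (integral {0..2*pi} (\<lambda>t. cmod (poly (multiplier n g P) (cis t)) powr p)
      * integral {0..2*pi} (\<lambda>t. cmod (1 + cis t) powr p))"
    by (simp add: A_def W_def power2_eq_square)
  also have "\<dots> \<le> 1 / (2*pi)^2 * (integral {0..2*pi} (\<lambda>t. cmod (g 0 + g n * cis t) powr p)
      * integral {0..2*pi} (\<lambda>t. cmod (poly P (cis t)) powr p))"
    by (intro mult_left_mono power_integral_nonvanishing[OF g g0 P p]) auto
  also have "\<dots> = G * K"
    by (simp add: G_def K_def power2_eq_square mult.commute)
  finally have "A \<le> G / W * K" using W by (simp add: field_simps)
  then have "A powr (1 / p) \<le> (G / W * K) powr (1 / p)"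
    using nonneg p by (intro powr_mono2) auto
  also have "\<dots> = G powr (1 / p) / W powr (1 / p) * K powr (1 / p)"
    using nonneg W by (simp add: powr_mult powr_divide)
  finally show ?thesis
    unfolding circle_norm_pos_exponent[OF False] A_def W_def G_def K_def .
qed

theorem corollary1:
  fixes n :: nat and l0 l1 l2 \<alpha> :: complex and p R :: real
  assumes "n \<ge> 1"
    and "B_class_params n l0 l1 l2"
    and "cmod \<alpha> \<le> 1"
    and "0 \<le> p"
    and "R > 1"
  shows "(\<forall>P \<in> poly_space n. (\<forall>z. cmod z < 1 \<longrightarrow> poly P z \<noteq> 0) \<longrightarrow>
            circle_norm p (B_op n l0 l1 l2 (P \<circ>\<^sub>p [:0, of_real R:]) - smult \<alpha> (B_op n l0 l1 l2 P))
            \<le> circle_norm p [:(1 - \<alpha>) * l0, (of_real R ^ n - \<alpha>) * Lambda n l0 l1 l2:]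
               / circle_norm p [:1, 1:] * circle_norm p P)
       \<and> (\<forall>a b P. cmod a = 1 \<and> cmod b = 1 \<and> P = monom a n + [:b:] \<longrightarrow>
            circle_norm p (B_op n l0 l1 l2 (P \<circ>\<^sub>p [:0, of_real R:]) - smult \<alpha> (B_op n l0 l1 l2 P))
            = circle_norm p [:(1 - \<alpha>) * l0, (of_real R ^ n - \<alpha>) * Lambda n l0 l1 l2:]
               / circle_norm p [:1, 1:] * circle_norm p P)"
proof (intro conjI ballI allI impI)
  define g where "g = dilation_B n l0 l1 l2 \<alpha> R"
  have ends: "g 0 = (1 - \<alpha>) * l0" "g n = (of_real R ^ n - \<alpha>) * Lambda n l0 l1 l2"
    by (simp_all add: g_def dilation_B_def B_symbol_0 B_symbol_n)
  have g: "admissible n g" unfolding g_def by (rule admissible_dilation_B[OF assms(1,2,3,5)])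
  have g0: "cmod (g 0) < cmod (g n)" unfolding g_def by (rule dilation_B_ends[OF assms(1,2,3,5)])
  show "circle_norm p (B_op n l0 l1 l2 (P \<circ>\<^sub>p [:0, of_real R:]) - smult \<alpha> (B_op n l0 l1 l2 P))
        \<le> circle_norm p [:(1 - \<alpha>) * l0, (of_real R ^ n - \<alpha>) * Lambda n l0 l1 l2:]
           / circle_norm p [:1, 1:] * circle_norm p P"
    if "P \<in> poly_space n" "\<forall>z. cmod z < 1 \<longrightarrow> poly P z \<noteq> 0" for P
    using circle_norm_multiplier_nonvanishing[OF g g0 _ _ assms(4), of P] that
    unfolding ends[symmetric] by (simp add: poly_space_def dilation_B_multiplier g_def)
  show "circle_norm p (B_op n l0 l1 l2 (P \<circ>\<^sub>p [:0, of_real R:]) - smult \<alpha> (B_op n l0 l1 l2 P))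
        = circle_norm p [:(1 - \<alpha>) * l0, (of_real R ^ n - \<alpha>) * Lambda n l0 l1 l2:]
           / circle_norm p [:1, 1:] * circle_norm p P"
    if "cmod a = 1 \<and> cmod b = 1 \<and> P = monom a n + [:b:]" for a b P
  proof -
    have P: "P = monom a n + [:b:]" "cmod a = 1" "cmod b = 1" using that by auto
    have "degree P \<le> n" unfolding P(1) by (intro degree_add_le) (auto intro: degree_monom_le)
    moreover have "multiplier n g P = monom (g n * a) n + [:g 0 * b:]"
      unfolding P(1) using assms(1)
      by (intro poly_eqI) (auto simp: coeff_multiplier coeff_pCons algebra_simps split: nat.splits)
    ultimately have "circle_norm p (B_op n l0 l1 l2 (P \<circ>\<^sub>p [:0, of_real R:]) - smult \<alpha> (B_op n l0 l1 l2 P))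
       = circle_norm p (monom (g n * a) n + [:g 0 * b:])"
      by (simp add: dilation_B_multiplier g_def)
    also have "\<dots> = circle_norm p [:g 0, g n:]"
      using admissible_coeff[OF g] P
      by (intro circle_norm_binomial[OF assms(1,4)]) (auto simp: norm_mult)
    moreover have "circle_norm p P = circle_norm p [:1, 1:]"
      unfolding P(1) using P by (intro circle_norm_binomial[OF assms(1,4)]) auto
    ultimately show ?thesis
      using circle_norm_one_plus_pos[OF assms(4)] unfolding ends[symmetric] by simp
  qed
qed

end
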